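(* Let $n$ be a positive integer and let $V$ be a semigroup variety. If every finite semigroup in $V$ satisfies the identities $$x^{2}=x^{n+2},\qquad xyx=(xy)^{n+1}x,\qquad (xhz)^nxyz=xyz(xhz)^n,$$ then every semigroup in $V$ satisfies these identities.
   Context: A semigroup variety is a class of semigroups defined by a set of semigroup identities. *)

theory Defs
  imports Main
begin

definition semigroup_on :: "'a set \<Rightarrow> ('a \<Rightarrow> 'a \<Rightarrow> 'a) \<Rightarrow> bool" where
  "semigroup_on S f \<longleftrightarrow> S \<noteq> {} \<and> (\<forall>a\<in>S. \<forall>b\<in>S. f a b \<in> S)
     \<and> (\<forall>a\<in>S. \<forall>b\<in>S. \<forall>c\<in>S. f (f a b) c = f a (f b c))"

text \<open>Semigroup words are non-empty lists over a countably infinite alphabet of letters.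
  This alphabet suffices for all sets of identities, since a single identity
  involves only finitely many letters.\<close>

type_synonym word = "nat list"

definition identities :: "(word \<times> word) set" where
  "identities = {(u, v). u \<noteq> [] \<and> v \<noteq> []}"

text \<open>The value of a non-empty word under an assignment of its letters; the value of the
  empty list is irrelevant and left unspecified.\<close>

fun word_value :: "('a \<Rightarrow> 'a \<Rightarrow> 'a) \<Rightarrow> (nat \<Rightarrow> 'a) \<Rightarrow> word \<Rightarrow> 'a" where
  "word_value f s [] = undefined"
| "word_value f s [i] = s i"
| "word_value f s (i # j # w) = f (s i) (word_value f s (j # w))"

definition satisfies :: "'a set \<Rightarrow> ('a \<Rightarrow> 'a \<Rightarrow> 'a) \<Rightarrow> word \<times> word \<Rightarrow> bool" where
  "satisfies S f e \<longleftrightarrow>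
     (\<forall>s. (\<forall>i. s i \<in> S) \<longrightarrow> word_value f s (fst e) = word_value f s (snd e))"

text \<open>The members, carried by subsets of the type \<open>'a\<close>, of the variety defined by \<open>E\<close>.
  The variety itself is the family of these sets for all \<open>'a\<close>.\<close>

definition variety :: "(word \<times> word) set \<Rightarrow> ('a set \<times> ('a \<Rightarrow> 'a \<Rightarrow> 'a)) set" where
  "variety E = {(S, f). semigroup_on S f \<and> (\<forall>e\<in>E. satisfies S f e)}"

definition word_power :: "word \<Rightarrow> nat \<Rightarrow> word" where
  "word_power w k = concat (replicate k w)"

text \<open>The identities \<open>x^2 = x^(n+2)\<close>, \<open>xyx = (xy)^(n+1) x\<close> and
  \<open>(xhz)^n xyz = xyz (xhz)^n\<close>.\<close>

definition xyzh_identities :: "nat \<Rightarrow> (word \<times> word) set" where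
  "xyzh_identities n = (let x = 0; y = 1; z = 2; h = 3 in
     {(word_power [x] 2, word_power [x] (n + 2)),
      ([x, y, x], word_power [x, y] (n + 1) @ [x]),
      (word_power [x, h, z] n @ [x, y, z], [x, y, z] @ word_power [x, h, z] n)})"

text \<open>Every finite semigroup is isomorphic to one whose carrier is a set of natural numbers.
  Hence quantifying over the finite members of a variety with carrier in
  \<open>nat\<close> amounts to quantifying over all of its finite members:\<close>

lemma word_value_hom:
  assumes "\<forall>a\<in>S. \<forall>b\<in>S. f a b \<in> S" "\<forall>a\<in>S. \<forall>b\<in>S. g (f a b) = h (g a) (g b)"
    "\<forall>i. s i \<in> S" "w \<noteq> []"
  shows "word_value f s w \<in> S \<and> g (word_value f s w) = word_value h (g \<circ> s) w"
  using assms(4) by (induction w rule: induct_list012) (use assms(1-3) in auto)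

lemma satisfies_iso:
  assumes "\<forall>a\<in>S. \<forall>b\<in>S. f a b \<in> S" "\<forall>a\<in>S. \<forall>b\<in>S. g (f a b) = h (g a) (g b)"
    "inj_on g S" "e \<in> identities"
  shows "satisfies (g ` S) h e \<longleftrightarrow> satisfies S f e"
proof
  obtain u v where e: "e = (u, v)" "u \<noteq> []" "v \<noteq> []"
    using assms(4) by (auto simp: identities_def)
  note hom = word_value_hom[OF assms(1,2)]
  {
    assume L: "satisfies (g ` S) h e"
    show "satisfies S f e"
      unfolding satisfies_def
    proof (intro allI impI)
      fix s :: "nat \<Rightarrow> 'a" assume s: "\<forall>i. s i \<in> S"
      have "word_value h (g \<circ> s) u = word_value h (g \<circ> s) v"
        using L s e by (auto simp: satisfies_def)
      then show "word_value f s (fst e) = word_value f s (snd e)"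
        using hom[OF s e(2)] hom[OF s e(3)] assms(3) e(1) by (simp add: inj_on_def)
    qed
  }
  {
    assume R: "satisfies S f e"
    show "satisfies (g ` S) h e"
      unfolding satisfies_def
    proof (intro allI impI)
      fix t :: "nat \<Rightarrow> 'b" assume t: "\<forall>i. t i \<in> g ` S"
      define s where "s = inv_into S g \<circ> t"
      have s: "\<forall>i. s i \<in> S" and "g \<circ> s = t"
        using t by (auto simp: s_def inv_into_into f_inv_into_f fun_eq_iff)
      then show "word_value h t (fst e) = word_value h t (snd e)"
        using hom[OF s e(2)] hom[OF s e(3)] R e(1) by (auto simp: satisfies_def)
    qed
  }
qed

lemma finite_members_nat:
  fixes S :: "'a set" and f :: "'a \<Rightarrow> 'a \<Rightarrow> 'a"
  assumes "E \<subseteq> identities" "e \<in> identities"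
    and nat: "\<forall>(T :: nat set, h) \<in> variety E. finite T \<longrightarrow> satisfies T h e"
    and S: "(S, f) \<in> variety E" "finite S"
  shows "satisfies S f e"
proof -
  obtain g :: "'a \<Rightarrow> nat" where g: "inj_on g S"
    using finite_imp_inj_to_nat_seg[OF S(2)] by blast
  define h where "h a b = g (f (inv_into S g a) (inv_into S g b))" for a b
  have cl: "\<forall>a\<in>S. \<forall>b\<in>S. f a b \<in> S" and ne: "S \<noteq> {}"
    and assoc: "\<forall>a\<in>S. \<forall>b\<in>S. \<forall>c\<in>S. f (f a b) c = f a (f b c)"
    using S(1) by (auto simp: variety_def semigroup_on_def)
  have hom: "\<forall>a\<in>S. \<forall>b\<in>S. g (f a b) = h (g a) (g b)"
    using g by (simp add: h_def)
  have "semigroup_on (g ` S) h"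
    using cl ne assoc g by (auto simp: semigroup_on_def h_def)
  then have "(g ` S, h) \<in> variety E"
    using S(1) assms(1) satisfies_iso[OF cl hom g] by (auto simp: variety_def)
  then show ?thesis
    using nat S(2) satisfies_iso[OF cl hom g assms(2)] by auto
qed

end

theory Submission
  imports Defs
begin

text \<open>The identities of a variety \<open>V\<close> form a fully invariant congruence \<open>\<approx>\<close> on words.  A congruence
  \<open>Q \<supseteq> \<approx>\<close> of finite index on some subsemigroup of words yields a finite member of \<open>V\<close>, so \<open>Q\<close> is
  compatible with the three identities there.  The theorem is proved by choosing such \<open>Q\<close> cleverly
  enough that compatibility with \<open>Q\<close> gives back \<open>\<approx>\<close> itself.

  \<^item> \<open>x\<^sup>2 \<approx> x\<^bsup>n+2\<^esup>\<close>: either the powers of a letter are finite in number modulo \<open>\<approx>\<close>, or \<open>V\<close> contains the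
    cyclic group of order \<open>n + 1\<close> (\<open>power_law\<close>).  Consequently suitable elements of a
    local monoid \<open>eSe\<close> generate finite semigroups, which shows that all elements of \<open>eSe\<close> lie in groups
    and that \<open>f y = f y f\<close> for \<open>f, y \<in> eSe\<close> with \<open>f\<close> idempotent (\<open>local_group\<close>, \<open>local_idempotent\<close>).

  \<^item> A dichotomy replaces the question whether the five-element Brandt semigroup \<open>B\<^sub>2\<close> lies in \<open>V\<close>:
    is every word over two letters that is equivalent to an alternating word itself alternating?
    If not, some power \<open>(xy)\<^sup>K\<close> equals a word with the factor \<open>xx\<close>, and then the set of words dividing an
    idempotent is closed under concatenation (\<open>idempotent_below_append\<close>).

  \<^item> \<open>xyx \<approx> (xy)\<^bsup>n+1\<^esup>x\<close>: if all words over \<open>{x, y}\<close> equivalent to \<open>xyx\<close> have few alternations of letters,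
    then the Rees quotient by the words that do not divide \<open>xyx\<close> is finite and gives the identity.
    Otherwise some word with many alternations is equivalent to \<open>xyx\<close>, and both
    sides of the dichotomy turn it into a multiple of \<open>xyxy\<close>, from which the identity follows by a
    stability argument (\<open>xyx_law\<close>).

  \<^item> The third identity: put \<open>q = xhz\<close>, \<open>a = xyz\<close>, \<open>e = q\<^bsup>2n\<^esup>\<close>.  The second identity gives
    \<open>q\<^sup>n a \<approx> e a\<close> and \<open>a q\<^sup>n \<approx> a e\<close>, so by left-right duality it suffices that \<open>e a \<approx> e a e\<close>.  If
    alternation is invariant, \<open>h\<close> and \<open>y\<close> may be modified so that \<open>q\<close> evaluates to \<open>e\<close> and \<open>a\<close>
    to \<open>e a\<close>; only words running through the cycle \<open>x, {h, y}, z\<close> matter, they are products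
    of \<open>e\<close> and \<open>e a\<close> up to a short prefix and suffix, and \<open>e (e a) = e a\<close> leaves only finitely many of them.
    If alternation is not invariant, \<open>q a\<close> lies in the minimal ideal \<open>K\<close> of the four-generated
    semigroup; there every word \<open>c u c\<close> that returns to its first letter acts as a constant on the
    set of minimal left ideals, so the action on this set is finite, and the third identity for it says that \<open>q\<^sup>n a\<close>
    lies in the left ideal generated by \<open>a q\<^sup>n\<close>.\<close>

section \<open>Words, powers and substitutions\<close>

notation word_power (infixr "\<up>" 80)

definition subst_word :: "(nat \<Rightarrow> word) \<Rightarrow> word \<Rightarrow> word" where
  "subst_word \<phi> w = concat (map \<phi> w)"

lemma subst_word_simps [simp]:
  "subst_word \<phi> [] = []"
  "subst_word \<phi> (a # w) = \<phi> a @ subst_word \<phi> w"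
  "subst_word \<phi> (u @ v) = subst_word \<phi> u @ subst_word \<phi> v"
  by (simp_all add: subst_word_def)

lemma word_power_0 [simp]: "w \<up> 0 = []"
  by (simp add: word_power_def)

lemma word_power_Suc: "w \<up> Suc k = w @ w \<up> k"
  by (simp add: word_power_def)

lemma word_power_1 [simp]: "w \<up> Suc 0 = w"
  by (simp add: word_power_def)

lemma word_power_2: "w \<up> 2 = w @ w"
  by (simp add: numeral_2_eq_2 word_power_Suc)

lemma word_power_add: "w \<up> (i + j) = w \<up> i @ w \<up> j"
  by (induction i) (simp_all add: word_power_Suc)

lemma word_power_commute: "w \<up> k @ w = w @ w \<up> k"
  by (induction k) (simp_all add: word_power_Suc)

lemma word_power_Suc_right: "w \<up> Suc k = w \<up> k @ w"
  by (simp add: word_power_Suc word_power_commute)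

lemma word_power_Nil [simp]: "[] \<up> k = []"
  by (induction k) (simp_all add: word_power_Suc)

lemma word_power_eq_Nil [simp]: "w \<up> k = [] \<longleftrightarrow> w = [] \<or> k = 0"
  by (induction k) (auto simp: word_power_Suc)

lemma word_power_slide: "(u @ v) \<up> k @ u = u @ (v @ u) \<up> k"
  by (induction k) (simp_all add: word_power_Suc)

lemma word_power_rotate: "(u @ v) \<up> Suc k = u @ (v @ u) \<up> k @ v"
  by (metis word_power_Suc_right word_power_slide append_assoc)

lemma subst_word_power [simp]: "subst_word \<phi> (w \<up> k) = subst_word \<phi> w \<up> k"
  by (induction k) (simp_all add: word_power_Suc)

lemma length_word_power [simp]: "length (w \<up> k) = k * length w"
  by (induction k) (simp_all add: word_power_Suc)

lemma set_word_power: "set (w \<up> k) \<subseteq> set w"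
  by (induction k) (auto simp: word_power_Suc)

lemma set_word_power_pos: "k > 0 \<Longrightarrow> set (w \<up> k) = set w"
  using set_word_power[of w] by (cases k) (auto simp: word_power_Suc)

lemma rev_word_power: "rev (w \<up> k) = rev w \<up> k"
proof (induction k)
  case (Suc k)
  then show ?case by (simp add: word_power_Suc word_power_commute)
qed simp

lemma subst_word_comp: "subst_word \<phi> (subst_word \<psi> w) = subst_word (subst_word \<phi> \<circ> \<psi>) w"
  by (induction w) simp_all

lemma set_subst_word: "set (subst_word \<phi> w) = (\<Union>i\<in>set w. set (\<phi> i))"
  by (induction w) auto

lemma subst_word_letters: "(\<And>i. i \<in> set w \<Longrightarrow> \<phi> i = [i]) \<Longrightarrow> subst_word \<phi> w = w"
  by (induction w) auto

section \<open>Congruences tested by finite quotients\<close>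

definition congruence :: "(word \<Rightarrow> word \<Rightarrow> bool) \<Rightarrow> bool" where
  "congruence Q \<longleftrightarrow> equivp Q \<and> (\<forall>u v p q. Q u v \<longrightarrow> Q (p @ u @ q) (p @ v @ q))"

lemma congruenceI:
  assumes "\<And>u. Q u u" "\<And>u v. Q u v \<Longrightarrow> Q v u" "\<And>u v w. Q u v \<Longrightarrow> Q v w \<Longrightarrow> Q u w"
    and "\<And>u v p q. Q u v \<Longrightarrow> Q (p @ u @ q) (p @ v @ q)"
  shows "congruence Q"
  unfolding congruence_def
proof (intro conjI allI impI equivpI reflpI sympI transpI)
qed (fact assms)+

lemma congruence_append:
  assumes "congruence Q" "Q u u'" "Q v v'"
  shows "Q (u @ v) (u' @ v')"
proof -
  have "Q ([] @ u @ v) ([] @ u' @ v)" "Q (u' @ v @ []) (u' @ v' @ [])"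
    using assms unfolding congruence_def by blast+
  moreover have "equivp Q"
    using assms(1) by (simp add: congruence_def)
  ultimately show ?thesis
    using equivp_transp[of Q "u @ v" "u' @ v"] by simp
qed

text \<open>The properties of the equational theory of \<open>V\<close> on which the proof relies.  The last one says that the
  identities hold in every finite quotient semigroup of a set \<open>A\<close> of words; it is stated for congruences
  \<open>Q\<close> above \<open>\<approx>\<close> that need not be fully invariant, such as Rees congruences.  All hypotheses are
  invariant under reversal of words, which makes duality available.\<close>

locale finitely_tested =
  fixes n :: nat and R :: "word \<Rightarrow> word \<Rightarrow> bool" (infix "\<approx>" 50)
  assumes pos: "n \<ge> 1"
    and cong: "congruence R"
    and subst: "u \<approx> v \<Longrightarrow> (\<And>i. \<phi> i \<noteq> []) \<Longrightarrow> subst_word \<phi> u \<approx> subst_word \<phi> v"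
    and eq_Nil: "u \<approx> v \<Longrightarrow> u = [] \<longleftrightarrow> v = []"
    and finite_test: "congruence Q \<Longrightarrow> (\<And>u v. u \<approx> v \<Longrightarrow> Q u v) \<Longrightarrow> finite A \<Longrightarrow> [] \<notin> A
        \<Longrightarrow> (\<And>a b. a \<in> A \<Longrightarrow> b \<in> A \<Longrightarrow> \<exists>c\<in>A. Q (a @ b) c)
        \<Longrightarrow> x \<in> A \<Longrightarrow> y \<in> A \<Longrightarrow> z \<in> A \<Longrightarrow> h \<in> A
        \<Longrightarrow> Q (x \<up> 2) (x \<up> (n + 2)) \<and> Q (x @ y @ x) ((x @ y) \<up> (n + 1) @ x)
          \<and> Q ((x @ h @ z) \<up> n @ x @ y @ z) ((x @ y @ z) @ (x @ h @ z) \<up> n)"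
begin

lemma refl [simp, intro]: "u \<approx> u"
  using cong by (simp add: congruence_def equivp_reflp)

lemma sym: "u \<approx> v \<Longrightarrow> v \<approx> u"
  using cong by (simp add: congruence_def equivp_symp)

lemma trans [trans]: "u \<approx> v \<Longrightarrow> v \<approx> w \<Longrightarrow> u \<approx> w"
  using cong unfolding congruence_def by (meson equivp_transp)

lemma eq_trans [trans]: "u = v \<Longrightarrow> v \<approx> w \<Longrightarrow> u \<approx> w" "u \<approx> v \<Longrightarrow> v = w \<Longrightarrow> u \<approx> w"
  by auto

lemma ctx: "u \<approx> v \<Longrightarrow> p @ u @ q \<approx> p @ v @ q"
  using cong by (simp add: congruence_def)

lemma append: "u \<approx> u' \<Longrightarrow> v \<approx> v' \<Longrightarrow> u @ v \<approx> u' @ v'"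
  by (rule congruence_append[OF cong])

lemma left: "u \<approx> v \<Longrightarrow> p @ u \<approx> p @ v"
  by (simp add: append)

lemma right: "u \<approx> v \<Longrightarrow> u @ q \<approx> v @ q"
  by (simp add: append)

lemma power: "u \<approx> v \<Longrightarrow> u \<up> k \<approx> v \<up> k"
  by (induction k) (simp_all add: word_power_Suc append)

text \<open>Once two powers of \<open>w\<close> coincide, boundedly many exponents represent all powers.\<close>

lemma finite_power_closed:
  assumes "congruence Q" and "Q (w \<up> (a + d)) (w \<up> a)" "d \<ge> 1" "a \<ge> 1" "i \<ge> 1"
  shows "\<exists>j. 1 \<le> j \<and> j < a + d \<and> Q (w \<up> i) (w \<up> j)"
  using assms(5)
proof (induction i rule: less_induct)
  case (less i)
  show ?case
  proof (cases "i < a + d")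
    case True
    then show ?thesis using less assms(1) by (auto simp: congruence_def equivp_reflp)
  next
    case False
    then obtain r where r: "i = (a + d) + r"
      using le_Suc_ex not_less by blast
    have "Q (w \<up> r) (w \<up> r)"
      using assms(1) by (simp add: congruence_def equivp_reflp)
    then have 1: "Q (w \<up> i) (w \<up> (a + r))"
      unfolding r word_power_add[of w "a + d"] word_power_add[of w a r]
      using congruence_append[OF assms(1,2)] by blast
    obtain j where "1 \<le> j" "j < a + d" "Q (w \<up> (a + r)) (w \<up> j)"
      using less.IH[of "a + r"] r assms(3,4) by auto
    then show ?thesis
      using 1 assms(1) by (meson congruence_def equivp_transp)
  qed
qed

text \<open>If no two powers of a letter are equivalent, then all equivalent words have the same length, so
  the length modulo \<open>n + 1\<close> is a congruence above \<open>\<approx>\<close>.  Its quotient is a cyclic group of order \<open>n + 1\<close>,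
  which violates \<open>x\<^sup>2 = x\<^bsup>n+2\<^esup>\<close>.\<close>

lemma power_law: "w \<up> 2 \<approx> w \<up> (n + 2)"
proof -
  have "[0] \<up> 2 \<approx> [0] \<up> (n + 2)"
  proof (cases "\<exists>i j. i < j \<and> [0] \<up> i \<approx> [0] \<up> j")
    case True
    then obtain i j where ij: "i < j" "[0] \<up> i \<approx> [0] \<up> j" by blast
    have "i \<ge> 1" using ij eq_Nil[OF ij(2)] by (cases i) auto
    define A where "A = (\<lambda>k. [0::nat] \<up> k) ` {1..<j}"
    have red: "\<exists>c\<in>A. [0] \<up> k \<approx> c" if k: "k \<ge> 1" for k
    proof -
      have "[0] \<up> (i + (j - i)) \<approx> [0] \<up> i"
        using ij sym by simp
      moreover have "j - i \<ge> 1" "i + (j - i) = j"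
        using ij(1) by auto
      ultimately obtain l where "1 \<le> l" "l < j" "[0] \<up> k \<approx> [0] \<up> l"
        using finite_power_closed[OF cong _ _ \<open>i \<ge> 1\<close> k] by metis
      then show ?thesis by (auto simp: A_def)
    qed
    have 1: "\<exists>c\<in>A. a @ b \<approx> c" if ab: "a \<in> A" "b \<in> A" for a b
    proof -
      obtain k l where "a = [0] \<up> k" "b = [0] \<up> l" "k \<ge> 1" "l \<ge> 1"
        using ab by (auto simp: A_def)
      then show ?thesis using red[of "k + l"] by (simp add: word_power_add)
    qed
    obtain x where x: "x \<in> A" "[0] \<approx> x"
      using red[of 1] by auto
    have A: "finite A" "[] \<notin> A"
      by (auto simp: A_def dest!: arg_cong[where f = length])
    have "x \<up> 2 \<approx> x \<up> (n + 2)"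
      using finite_test[OF cong _ A 1 x(1) x(1) x(1) x(1)] by blast
    from trans[OF trans[OF power[OF x(2)] this] sym[OF power[OF x(2)]]] show ?thesis .
  next
    case False
    then have inj: "i = j" if "[0] \<up> i \<approx> [0] \<up> j" for i j
      using that sym[OF that] by (metis linorder_neqE_nat)
    have len: "length u = length v" if "u \<approx> v" for u v
    proof -
      have [simp]: "subst_word (\<lambda>_. [0]) w = [0] \<up> length w" for w
        by (induction w) (simp_all add: word_power_Suc)
      show ?thesis using inj subst[OF that, of "\<lambda>_. [0]"] by simp
    qed
    define Q where "Q u v \<longleftrightarrow> length u mod (n + 1) = length v mod (n + 1)" for u v :: word
    define A where "A = (\<lambda>k. [0::nat] \<up> k) ` {1..n + 1}"
    have Q: "congruence Q"
      by (rule congruenceI) (auto simp: Q_def intro!: mod_add_cong)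
    have 1: "\<exists>c\<in>A. Q (a @ b) c" if ab: "a \<in> A" "b \<in> A" for a b
    proof -
      define r where "r = (length a + length b) mod (n + 1)"
      have "Q (a @ b) ([0] \<up> (if r = 0 then n + 1 else r))" "r < n + 1"
        by (auto simp: Q_def r_def)
      then show ?thesis by (auto simp: A_def split: if_splits)
    qed
    have A: "finite A" "[] \<notin> A"
      by (auto simp: A_def dest!: arg_cong[where f = length])
    have x: "[0] \<in> A"
      using word_power_1[of "[0]"] by (force simp: A_def simp del: word_power_1)
    have "Q ([0] \<up> 2) ([0] \<up> (n + 2))"
      using finite_test[OF Q _ A 1 x x x x] len by (auto simp: Q_def)
    then have "(2 + n) mod (n + 1) = 2 mod (n + 1)"
      by (simp add: Q_def)
    then have "1 mod (n + 1) = 2 mod (n + 1)"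
      using mod_add_self1[of "n + 1" 1] by simp
    then have False using pos
      by (cases "n = 1") (simp_all add: numeral_2_eq_2)
    then show ?thesis ..
  qed
  from subst[OF this, of "\<lambda>_. w"] show ?thesis
    by (cases "w = []") simp_all
qed

lemma power_reduce:
  assumes "k \<ge> 2"
  shows "w \<up> (k + n * j) \<approx> w \<up> k"
proof (induction j)
  case (Suc j)
  have "k + n * Suc j = (n + 2) + (k - 2 + n * j)"
    using assms by simp
  then have "w \<up> (k + n * Suc j) = w \<up> (n + 2) @ w \<up> (k - 2 + n * j)"
    by (simp only: word_power_add)
  also have "\<dots> \<approx> w \<up> 2 @ w \<up> (k - 2 + n * j)"
    by (intro right sym[OF power_law])
  also have "\<dots> = w \<up> (k + n * j)"
    using assms by (simp del: add_2_eq_Suc flip: word_power_add)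
  also note Suc
  finally show ?case .
qed simp

lemma short_power: "\<exists>j \<le> n + 1. w \<up> k \<approx> w \<up> j"
proof (cases "k = 0")
  case False
  have "w \<up> (2 + n) \<approx> w \<up> 2"
    using sym[OF power_law[of w]] by (simp only: add.commute[of 2 n])
  from finite_power_closed[OF cong this pos, of k] obtain j
    where "j < 2 + n" "w \<up> k \<approx> w \<up> j"
    using False by auto
  then show ?thesis
    by (intro exI[of _ j]) simp
qed auto

text \<open>The exponent \<open>n\<close> does not suffice to make \<open>w \<up> n\<close> idempotent when \<open>n = 1\<close>; \<open>2 * n\<close> always does.\<close>

abbreviation idem :: "word \<Rightarrow> word" where
  "idem w \<equiv> w \<up> (2 * n)"

lemma idem_idem: "idem w @ idem w \<approx> idem w"
proof -
  have "2 * n + n * 2 = 2 * n + 2 * n" "2 * n \<ge> 2"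
    using pos by simp_all
  then show ?thesis
    using power_reduce[of "2 * n" w 2] by (simp only: word_power_add)
qed

lemma idem_absorb: "k \<ge> 2 \<Longrightarrow> idem w @ w \<up> k \<approx> w \<up> k"
  using power_reduce[of k w 2]
  by (simp only: add.commute[of k] mult.commute[of n] word_power_add)

lemma idempotent_power: "e @ e \<approx> e \<Longrightarrow> e \<up> Suc k \<approx> e"
proof (induction k)
  case (Suc k)
  then have "e @ e \<up> Suc k \<approx> e @ e"
    by (intro left) simp
  also note Suc.prems
  finally show ?case by (simp only: word_power_Suc)
qed simp

end

section \<open>Divisibility and local monoids\<close>

context finitely_tested
begin

definition below :: "word \<Rightarrow> word \<Rightarrow> bool" (infix "\<preceq>" 50) where
  "a \<preceq> b \<longleftrightarrow> (\<exists>p q. a \<approx> p @ b @ q)"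

lemma belowI: "a \<approx> p @ b @ q \<Longrightarrow> a \<preceq> b"
  by (auto simp: below_def)

lemma below_factor: "p @ b @ q \<preceq> b"
  by (rule belowI[of _ p _ q]) simp

lemma below_refl: "a \<preceq> a"
  using below_factor[of "[]" a "[]"] by simp

lemma below_trans [trans]:
  assumes "a \<preceq> b" "b \<preceq> c"
  shows "a \<preceq> c"
proof -
  obtain p q where 1: "a \<approx> p @ b @ q" using assms(1) by (auto simp: below_def)
  obtain r s where 2: "b \<approx> r @ c @ s" using assms(2) by (auto simp: below_def)
  from trans[OF 1 ctx[OF 2]] have "a \<approx> (p @ r) @ c @ (s @ q)" by simp
  then show ?thesis by (rule belowI)
qed

lemma eqv_below [trans]: "a \<approx> b \<Longrightarrow> b \<preceq> c \<Longrightarrow> a \<preceq> c"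
  unfolding below_def using trans[of a b] by blast

lemma below_eqv [trans]: "a \<preceq> b \<Longrightarrow> b \<approx> c \<Longrightarrow> a \<preceq> c"
  using below_trans[of a b c] belowI[of b "[]" c "[]"] by simp

text \<open>Stability of periodic semigroups: iterating \<open>a \<approx> p a q\<close> gives \<open>a \<approx> p\<^bsup>2n\<^esup> a q\<^bsup>2n\<^esup>\<close>, where both outer factors
  are idempotent.\<close>

lemma stable:
  assumes "a \<approx> p @ a @ q"
  shows "a \<approx> idem p @ a" "a \<approx> a @ idem q"
proof -
  have "a \<approx> p \<up> k @ a @ q \<up> k" for k
  proof (induction k)
    case (Suc k)
    have "a \<approx> p @ a @ q" by fact
    also have "\<dots> \<approx> p @ (p \<up> k @ a @ q \<up> k) @ q" by (intro ctx Suc)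
    also have "\<dots> = p \<up> Suc k @ a @ q \<up> Suc k"
      by (simp add: word_power_Suc word_power_commute)
    finally show ?case .
  qed simp
  then have 1: "a \<approx> idem p @ a @ idem q" .
  have "idem p @ a \<approx> idem p @ idem p @ a @ idem q" by (rule left[OF 1])
  also have "\<dots> \<approx> idem p @ a @ idem q"
    using right[OF idem_idem] by simp
  also note sym[OF 1]
  finally show "a \<approx> idem p @ a" by (rule sym)
  have "a @ idem q \<approx> (idem p @ a @ idem q) @ idem q" by (rule right[OF 1])
  also have "\<dots> \<approx> idem p @ a @ idem q"
    using left[OF idem_idem, of "idem p @ a"] by simp
  also note sym[OF 1]
  finally show "a \<approx> a @ idem q" by (rule sym)
qed

text \<open>The identity \<open>e\<close> and the powers of \<open>y\<close> form a finite monoid, in which \<open>xyx = (xy)\<^bsup>n+1\<^esup>x\<close> at \<open>x = e\<close> reads \<open>y = y\<^bsup>n+1\<^esup>\<close>.\<close>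

lemma local_group:
  assumes e: "e \<noteq> []" "e @ e \<approx> e" and y: "e @ y \<approx> y" "y @ e \<approx> y"
  shows "y \<approx> y \<up> (n + 1)"
proof (cases "y = []")
  case False
  define A where "A = insert e ((\<lambda>k. y \<up> k) ` {1..n + 1})"
  have red: "\<exists>c\<in>A. y \<up> k \<approx> c" if k: "k \<ge> 1" for k
  proof -
    have "y \<up> (2 + n) \<approx> y \<up> 2"
      using sym[OF power_law[of y]] by (simp only: add.commute[of 2 n])
    from finite_power_closed[OF cong this pos _ k] obtain j
      where "1 \<le> j" "j < 2 + n" "y \<up> k \<approx> y \<up> j"
      by auto
    then show ?thesis by (auto simp: A_def)
  qed
  have ey: "e @ y \<up> k \<approx> y \<up> k" "y \<up> k @ e \<approx> y \<up> k" if "k \<ge> 1" for k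
  proof -
    from that obtain l where k: "k = Suc l" by (cases k) auto
    show "e @ y \<up> k \<approx> y \<up> k"
      using right[OF y(1)] by (simp add: k word_power_Suc)
    show "y \<up> k @ e \<approx> y \<up> k"
      using left[OF y(2)] by (simp add: k word_power_Suc_right)
  qed
  have mem: "y \<up> k \<in> A" if "1 \<le> k" "k \<le> n + 1" for k
    using that by (auto simp: A_def)
  have cl: "\<exists>c\<in>A. a @ b \<approx> c" if ab: "a \<in> A" "b \<in> A" for a b
  proof -
    consider "a = e" "b = e" | k where "a = e" "b = y \<up> k" "1 \<le> k" "k \<le> n + 1"
      | k where "a = y \<up> k" "b = e" "1 \<le> k" "k \<le> n + 1"
      | k l where "a = y \<up> k" "b = y \<up> l" "1 \<le> k"
      using ab by (auto simp: A_def)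
    then show ?thesis
    proof cases
      case 1
      then show ?thesis using e(2) by (auto simp: A_def)
    next
      case (2 k)
      then show ?thesis using ey(1) mem by blast
    next
      case (3 k)
      then show ?thesis using ey(2) mem by blast
    next
      case (4 k l)
      then show ?thesis using red[of "k + l"] by (simp add: word_power_add)
    qed
  qed
  have A: "finite A" "[] \<notin> A"
    using e(1) False by (auto simp: A_def dest!: arg_cong[where f = length])
  have "e \<in> A" "y \<in> A"
    using mem[of 1] by (auto simp: A_def)
  with finite_test[OF cong _ A cl, of e y] have "e @ y @ e \<approx> (e @ y) \<up> (n + 1) @ e"
    by blast
  also have "\<dots> \<approx> y \<up> (n + 1) @ e" by (intro right power y)
  also have "\<dots> \<approx> y \<up> (n + 1)" by (rule ey) simp
  finally have 1: "e @ y @ e \<approx> y \<up> (n + 1)" .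
  have "e @ y @ e \<approx> e @ y" by (rule left[OF y(2)])
  also note y(1)
  finally have "y \<approx> e @ y @ e" by (rule sym)
  also note 1
  finally show ?thesis .
qed simp

text \<open>The monoid generated by \<open>f\<close> and \<open>y\<close> may be infinite.  Replacing \<open>y\<close> by the idempotent \<open>g = (f y)\<^bsup>2n\<^esup>\<close>, for which
  \<open>f g = g\<close>, leaves the four elements \<open>e, f, g, g f\<close>; the third identity at \<open>x = z = e\<close> makes \<open>f\<close> and \<open>g\<close> commute.
  Since \<open>f y\<close> is a group element with identity \<open>g\<close>, the claim for \<open>y\<close> follows from \<open>g = g f\<close>.\<close>

lemma local_idempotent:
  assumes e: "e \<noteq> []" "e @ e \<approx> e" and f: "f \<noteq> []" "f @ f \<approx> f" "e @ f \<approx> f" "f @ e \<approx> f"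
    and y: "e @ y \<approx> y" "y @ e \<approx> y"
  shows "f @ y \<approx> f @ y @ f"
proof -
  define g where "g = idem (f @ y)"
  obtain m where m: "2 * n = Suc m" using pos by (cases "2 * n") auto
  have g: "g \<noteq> []" using f(1) pos by (simp add: g_def)
  have fg: "f @ g \<approx> g"
    using right[OF f(2)] by (simp add: g_def m word_power_Suc)
  have eg: "e @ g \<approx> g"
    using right[OF f(3)] by (simp add: g_def m word_power_Suc)
  have ge: "g @ e \<approx> g"
    using left[OF y(2), of "(f @ y) \<up> m @ f"] by (simp add: g_def m word_power_Suc_right)
  have gg: "g @ g \<approx> g" unfolding g_def by (rule idem_idem)
  define A where "A = {e, f, g, g @ f}"
  have gfg: "g @ f @ g \<approx> g"
    by (rule trans[OF left[OF fg] gg])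
  have gfgf: "g @ f @ g @ f \<approx> g @ f"
    using right[OF gfg, of f] by simp
  have gfe: "g @ f @ e \<approx> g @ f" and gff: "g @ f @ f \<approx> g @ f"
    by (rule left[OF f(4)], rule left[OF f(2)])
  have egf: "e @ g @ f \<approx> g @ f" and fgf: "f @ g @ f \<approx> g @ f" and ggf: "g @ g @ f \<approx> g @ f"
    using right[OF eg, of f] right[OF fg, of f] right[OF gg, of f] by simp_all
  have cl: "\<exists>c\<in>A. a @ b \<approx> c" if "a \<in> A" "b \<in> A" for a b
    using that unfolding A_def
    by (elim insertE emptyE)
      (simp_all add: e(2) f(2-4) fg eg ge gg gfg gfgf gfe gff egf fgf ggf)
  have A: "finite A" "[] \<notin> A" "e \<in> A" "f \<in> A" "g \<in> A"
    using e(1) f(1) g by (auto simp: A_def)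
  have efe: "(e @ f @ e) \<up> n \<approx> f"
  proof -
    obtain k where k: "n = Suc k" using pos by (cases n) auto
    have "e @ f @ e \<approx> f"
      using trans[OF left[OF f(4)] f(3)] .
    then have "(e @ f @ e) \<up> n \<approx> f \<up> n" by (rule power)
    also have "\<dots> \<approx> f" unfolding k by (rule idempotent_power[OF f(2)])
    finally show ?thesis .
  qed
  have ege: "e @ g @ e \<approx> g"
    using trans[OF left[OF ge] eg] .
  have "(e @ f @ e) \<up> n @ e @ g @ e \<approx> (e @ g @ e) @ (e @ f @ e) \<up> n"
    using finite_test[OF cong _ A(1,2) cl A(3,5,3,4)] by simp
  from trans[OF sym[OF append[OF efe ege]] trans[OF this append[OF ege efe]]]
  have "f @ g \<approx> g @ f" .
  from trans[OF sym[OF fg] this] have gf: "g \<approx> g @ f" .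
  have "f @ y \<approx> (f @ y) \<up> (n + 1)"
  proof (rule local_group[OF e])
    show "e @ f @ y \<approx> f @ y" "(f @ y) @ e \<approx> f @ y"
      using right[OF f(3)] left[OF y(2)] by simp_all
  qed
  then have fy: "f @ y \<approx> (f @ y) @ g"
  proof -
    have "(f @ y) \<up> (n + 1) \<approx> (f @ y) \<up> (n + 1 + n * 1)"
      using pos by (intro sym[OF power_reduce]) simp
    also have "n + 1 + n * 1 = Suc (2 * n)" by simp
    finally show ?thesis
      using trans[OF \<open>f @ y \<approx> (f @ y) \<up> (n + 1)\<close>, of "(f @ y) \<up> Suc (2 * n)"]
      by (simp add: g_def word_power_Suc)
  qed
  have "f @ y \<approx> (f @ y) @ g" by (rule fy)
  also have "\<dots> \<approx> (f @ y) @ g @ f" by (rule left[OF gf])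
  also have "\<dots> \<approx> f @ y @ f" using right[OF sym[OF fy], of f] by simp
  finally show ?thesis .
qed

end

section \<open>Invariance of alternating words\<close>

lemma alternating_prefix_of_power:
  assumes "set u \<subseteq> {0, 1}" "distinct_adj u" "u \<noteq> []"
  shows "\<exists>K t. (if hd u = 0 then u else 0 # u) @ t = [0, 1] \<up> K"
  using assms
proof (induction u rule: induct_list012)
  case (2 a)
  then show ?case
    by (intro exI[of _ 1] exI[of _ "if a = 0 then [1] else []"]) auto
next
  case (3 a b u)
  then obtain K t where "(if b = 0 then b # u else 0 # b # u) @ t = [0, 1] \<up> K"
    by auto
  with 3 show ?case
    by (intro exI[of _ "if a = 0 then K else Suc K"] exI[of _ t]) (auto simp: word_power_Suc)
qed simp

lemma not_distinct_adj_decomp: "\<not> distinct_adj w \<Longrightarrow> \<exists>p a q. w = p @ [a, a] @ q"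
proof (induction w rule: induct_list012)
  case (3 a b w)
  show ?case
  proof (cases "a = b")
    case True
    then show ?thesis by (intro exI[of _ "[]"]) auto
  next
    case False
    with 3 obtain p c q where "b # w = p @ [c, c] @ q" by auto
    then show ?thesis by (intro exI[of _ "a # p"] exI[of _ c] exI[of _ q]) simp
  qed
qed auto

context finitely_tested
begin

text \<open>The alternating words over two letters are the words with a non-zero value under \<open>0 \<mapsto> e\<^sub>1\<^sub>2\<close>, \<open>1 \<mapsto> e\<^sub>2\<^sub>1\<close> in the Brandt
  semigroup of \<open>2 \<times> 2\<close> matrix units.  Thus this condition plays the part of the membership of that
  semigroup in the variety, without the semigroup having to be constructed.\<close>

definition alternating_invariant :: bool where
  "alternating_invariant \<longleftrightarrow> (\<forall>u v. set u \<subseteq> {0, 1} \<longrightarrow> set v \<subseteq> {0, 1} \<longrightarrow> u \<approx> v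
     \<longrightarrow> distinct_adj u \<longrightarrow> distinct_adj v)"

text \<open>An alternating word is a factor of a power of \<open>01\<close>; replacing it there by an equivalent word that
  is not alternating creates a factor \<open>00\<close> or \<open>11\<close>, and conjugation exchanges the two letters.\<close>

lemma square_in_power:
  assumes "\<not> alternating_invariant" "x \<noteq> []" "y \<noteq> []"
  shows "\<exists>K. (x @ y) \<up> K \<preceq> x @ x"
proof -
  obtain u v where uv: "set u \<subseteq> {0, 1}" "set v \<subseteq> {0, 1}" "u \<approx> v" "distinct_adj u" "\<not> distinct_adj v"
    using assms(1) by (auto simp: alternating_invariant_def)
  have "u \<noteq> []" using eq_Nil[OF uv(3)] uv(5) by auto
  then obtain K t where "(if hd u = 0 then u else 0 # u) @ t = [0, 1] \<up> K"
    using alternating_prefix_of_power[OF uv(1,4)] by blast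
  moreover define s :: word where "s = (if hd u = 0 then [] else [0])"
  ultimately have K: "s @ u @ t = [0, 1] \<up> K"
    by (simp split: if_splits)
  obtain p a q where v: "v = p @ [a, a] @ q"
    using not_distinct_adj_decomp[OF uv(5)] by blast
  have 1: "[0, 1] \<up> K \<preceq> [a, a]"
    using belowI[of "[0, 1] \<up> K" "s @ p" "[a, a]" "q @ t"] ctx[OF uv(3), of s t] by (simp add: K v)
  have sub: "subst_word \<phi> ([0, 1] \<up> K) \<preceq> subst_word \<phi> [a, a]" if "\<And>i. \<phi> i \<noteq> []" for \<phi>
  proof -
    obtain p q where "[0, 1] \<up> K \<approx> p @ [a, a] @ q"
      using 1 by (auto simp: below_def)
    from subst[OF this that] show ?thesis
      by (intro belowI[of _ "subst_word \<phi> p" _ "subst_word \<phi> q"]) simp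
  qed
  have "a = 0 \<or> a = 1" using uv(2) v by auto
  then show ?thesis
  proof
    assume "a = 0"
    then show ?thesis
      using sub[of "\<lambda>i. if i = 0 then x else y"] assms(2,3) by (intro exI[of _ K]) simp
  next
    assume "a = 1"
    then have "(y @ x) \<up> K \<preceq> x @ x"
      using sub[of "\<lambda>i. if i = 0 then y else x"] assms(2,3) by simp
    moreover have "(x @ y) \<up> Suc K \<preceq> (y @ x) \<up> K"
      unfolding word_power_rotate by (rule below_factor)
    ultimately have "(x @ y) \<up> Suc K \<preceq> x @ x" by (rule below_trans[rotated])
    then show ?thesis ..
  qed
qed

text \<open>With \<open>g = p u q = p' v q'\<close> the powers of \<open>g\<close> contain all powers of \<open>X T\<close> for \<open>X = v q' p u\<close> and a
  suitable \<open>T\<close>, hence \<open>X X\<close> by the previous lemma.  Where the two copies of \<open>X\<close> meet, the final \<open>u\<close> of the first is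
  followed by the initial \<open>v\<close> of the second.\<close>

lemma idempotent_below_append:
  assumes H: "\<not> alternating_invariant" and g: "g @ g \<approx> g" and u: "g \<preceq> u" and v: "g \<preceq> v"
  shows "g \<preceq> u @ v"
proof (cases "u = []")
  case False
  obtain p q where 1: "g \<approx> p @ u @ q" using u by (auto simp: below_def)
  obtain p' q' where 2: "g \<approx> p' @ v @ q'" using v by (auto simp: below_def)
  define T where "T = q @ p'"
  define X where "X = v @ q' @ p @ u"
  have "g \<approx> g @ g" by (rule sym[OF g])
  also have "\<dots> \<approx> (p @ u @ q) @ p' @ v @ q'" by (rule append[OF 1 2])
  finally have g1: "g \<approx> (p @ u @ T) @ (v @ q')" by (simp add: T_def)
  show ?thesis
  proof (cases "T = []")
    case True
    then show ?thesis using belowI[of g p "u @ v" q'] g1 by simp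
  next
    case T: False
    obtain K where K: "(X @ T) \<up> K \<preceq> X @ X"
      using square_in_power[OF H _ T, of X] False by (auto simp: X_def)
    have "g \<approx> g \<up> Suc K" by (rule sym[OF idempotent_power[OF g]])
    also have "\<dots> \<approx> ((p @ u @ T) @ (v @ q')) \<up> Suc K" by (rule power[OF g1])
    also have "\<dots> = (p @ u @ T) @ (X @ T) \<up> K @ (v @ q')"
      unfolding word_power_rotate by (simp add: X_def)
    also have "\<dots> \<preceq> (X @ T) \<up> K" by (rule below_factor)
    also note K
    also have "X @ X = (v @ q' @ p) @ (u @ v) @ (q' @ p @ u)" by (simp add: X_def)
    also have "\<dots> \<preceq> u @ v" by (rule below_factor)
    finally show ?thesis .
  qed
qed (simp add: v)

end

section \<open>The identity for xyx\<close>

text \<open>A word over \<open>{0, 1}\<close> without three disjoint factors \<open>01\<close> is a product of at most six powers of letters, so by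
  \<open>x\<^sup>2 \<approx> x\<^bsup>n+2\<^esup>\<close> there are finitely many such words modulo \<open>\<approx>\<close>.  Three is the number needed below: the outer two
  occurrences delimit a factor \<open>X Y X\<close> with \<open>X = 01\<close> in which \<open>Y\<close> still contains \<open>01\<close>.\<close>

definition thrice_01 :: "word \<Rightarrow> bool" where
  "thrice_01 w \<longleftrightarrow> (\<exists>p m m' q. w = p @ [0, 1] @ m @ [0, 1] @ m' @ [0, 1] @ q)"

lemma thrice_01_factor:
  assumes "thrice_01 w"
  shows "thrice_01 (p @ w @ q)"
proof -
  obtain r m m' s where "w = r @ [0, 1] @ m @ [0, 1] @ m' @ [0, 1] @ s"
    using assms unfolding thrice_01_def by blast
  then have "p @ w @ q = (p @ r) @ [0, 1] @ m @ [0, 1] @ m' @ [0, 1] @ (s @ q)"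
    by simp
  then show ?thesis unfolding thrice_01_def by blast
qed

lemma split_at_01:
  assumes "set w \<subseteq> {0, 1}"
  shows "(\<exists>a b. w = [1] \<up> a @ [0] \<up> b) \<or> (\<exists>a b r. w = ([1] \<up> a @ [0] \<up> b) @ [0, 1] @ r)"
  using assms
proof (induction w)
  case Nil
  show ?case by (intro disjI1 exI[of _ 0]) simp
next
  case (Cons c w)
  then have "c = 0 \<or> c = 1" and
    IH: "(\<exists>a b. w = [1] \<up> a @ [0] \<up> b) \<or> (\<exists>a b r. w = ([1] \<up> a @ [0] \<up> b) @ [0, 1] @ r)"
    by auto
  from IH obtain a b s where w: "w = [1] \<up> a @ [0] \<up> b @ s" and s: "s = [] \<or> (\<exists>r. s = [0, 1] @ r)"
    by (metis append_Nil2 append_assoc)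
  from \<open>c = 0 \<or> c = 1\<close> show ?case
  proof
    assume "c = 1"
    then have "c # w = ([1] \<up> Suc a @ [0] \<up> b) @ s" by (simp add: w word_power_Suc)
    with s show ?case by (metis append_Nil2)
  next
    assume c: "c = 0"
    show ?case
    proof (cases a)
      case 0
      then have "c # w = ([1] \<up> 0 @ [0] \<up> Suc b) @ s" by (simp add: w c word_power_Suc)
      with s show ?thesis by (metis append_Nil2)
    next
      case (Suc a')
      then have "c # w = ([1] \<up> 0 @ [0] \<up> 0) @ [0, 1] @ ([1] \<up> a' @ [0] \<up> b @ s)"
        by (simp add: w c word_power_Suc)
      then show ?thesis by blast
    qed
  qed
qed

lemma binary_square:
  assumes "set w \<subseteq> {0, 1::nat}" "length w \<ge> 4"
  shows "\<exists>p r q. w = p @ r @ r @ q \<and> r \<noteq> []"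
proof -
  obtain a b c d v where w: "w = a # b # c # d # v"
    using assms(2) by (cases w rule: list.exhaust; simp; metis Suc_le_length_iff numeral_3_eq_3)
  consider "a = b" | "b = c" | "c = d" | "c = a" "d = b"
    using assms(1) w by auto
  then show ?thesis
  proof cases
    case 1
    then show ?thesis by (intro exI[of _ "[]"] exI[of _ "[a]"] exI[of _ "c # d # v"]) (simp add: w)
  next
    case 2
    then show ?thesis by (intro exI[of _ "[a]"] exI[of _ "[b]"] exI[of _ "d # v"]) (simp add: w)
  next
    case 3
    then show ?thesis by (intro exI[of _ "[a, b]"] exI[of _ "[c]"] exI[of _ v]) (simp add: w)
  next
    case 4
    then show ?thesis by (intro exI[of _ "[]"] exI[of _ "[a, b]"] exI[of _ v]) (simp add: w)
  qed
qed

context finitely_tested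
begin

lemma short_block:
  "\<exists>w. [1] \<up> a @ [0] \<up> b \<approx> w \<and> length w \<le> 2 * (n + 1) \<and> set w \<subseteq> {0, 1}"
proof -
  obtain i where i: "i \<le> n + 1" "[1] \<up> a \<approx> [1] \<up> i" using short_power by blast
  obtain j where j: "j \<le> n + 1" "[0] \<up> b \<approx> [0] \<up> j" using short_power by blast
  have "set ([1] \<up> i @ [0] \<up> j) \<subseteq> {0, 1}"
    using set_word_power[of "[1]" i] set_word_power[of "[0]" j] by auto
  moreover have "length ([1] \<up> i @ [0] \<up> j) \<le> 2 * (n + 1)" using i(1) j(1) by simp
  ultimately show ?thesis using append[OF i(2) j(2)] by blast
qed

lemma short_if_not_thrice_01:
  assumes w: "set w \<subseteq> {0, 1}" "\<not> thrice_01 w"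
  shows "\<exists>w'. w \<approx> w' \<and> length w' \<le> 6 * (n + 1) + 4 \<and> set w' \<subseteq> {0, 1}"
proof -
  have *: "(\<exists>w'. r \<approx> w' \<and> length w' \<le> 2 * (n + 1) \<and> set w' \<subseteq> {0, 1}) \<or>
      (\<exists>b w' s. r = b @ [0, 1] @ s \<and> b \<approx> w' \<and> length w' \<le> 2 * (n + 1) \<and> set w' \<subseteq> {0, 1})"
    if "set r \<subseteq> {0, 1}" for r
    using split_at_01[OF that]
  proof (elim disjE exE)
    fix a b
    assume "r = [1] \<up> a @ [0] \<up> b"
    then show ?thesis using short_block[of a b] by (intro disjI1) simp
  next
    fix a b s
    assume "r = ([1] \<up> a @ [0] \<up> b) @ [0, 1] @ s"
    then show ?thesis using short_block[of a b] by blast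
  qed
  consider w' where "w \<approx> w'" "length w' \<le> 2 * (n + 1)" "set w' \<subseteq> {0, 1}"
    | b w' s where "w = b @ [0, 1] @ s" "b \<approx> w'" "length w' \<le> 2 * (n + 1)" "set w' \<subseteq> {0, 1}"
    using *[OF w(1)] by blast
  then show ?thesis
  proof cases
    case (1 w')
    then show ?thesis by (intro exI[of _ w']) auto
  next
    case (2 b w' s)
    note B = 2
    have s: "set s \<subseteq> {0, 1}" using w(1) B(1) by auto
    consider v where "s \<approx> v" "length v \<le> 2 * (n + 1)" "set v \<subseteq> {0, 1}"
      | c v t where "s = c @ [0, 1] @ t" "c \<approx> v" "length v \<le> 2 * (n + 1)" "set v \<subseteq> {0, 1}"
      using *[OF s] by blast
    then show ?thesis
    proof cases
      case (1 v)
      have "w \<approx> w' @ [0, 1] @ v"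
        unfolding B(1) by (intro append B 1 refl)
      then show ?thesis
        using B 1 by (intro exI[of _ "w' @ [0, 1] @ v"]) auto
    next
      case (2 c v t)
      note C = 2
      have t: "set t \<subseteq> {0, 1}" using s C(1) by auto
      consider u where "t \<approx> u" "length u \<le> 2 * (n + 1)" "set u \<subseteq> {0, 1}"
        | d r where "t = d @ [0, 1] @ r"
        using *[OF t] by blast
      then show ?thesis
      proof cases
        case (1 u)
        have "w \<approx> w' @ [0, 1] @ v @ [0, 1] @ u"
          unfolding B(1) C(1) append_assoc by (intro append B C 1 refl)
        then show ?thesis
          using B C 1 by (intro exI[of _ "w' @ [0, 1] @ v @ [0, 1] @ u"]) auto
      next
        case (2 d r)
        then have "thrice_01 w"
          unfolding thrice_01_def B(1) C(1) by (metis append_assoc)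
        with w(2) show ?thesis by blast
      qed
    qed
  qed
qed

text \<open>Writing \<open>a = xyx\<close>, the hypothesis has the form \<open>a \<approx> p a (y q)\<close>, so stability gives \<open>a \<approx> a y r\<close> for some \<open>r\<close>;
  and the factor \<open>a y = (xy)\<^sup>2\<close> absorbs \<open>(xy)\<^sup>n\<close> on its left.\<close>

lemma xyx_if_below_xyxy:
  assumes "x @ y @ x \<preceq> x @ y @ x @ y"
  shows "x @ y @ x \<approx> (x @ y) \<up> (n + 1) @ x"
proof -
  define a where "a = x @ y @ x"
  obtain p q where "a \<approx> p @ (x @ y @ x @ y) @ q"
    using assms by (auto simp: below_def a_def)
  then have "a \<approx> p @ a @ (y @ q)" by (simp add: a_def)
  from stable(2)[OF this] have 1: "a \<approx> a @ idem (y @ q)" .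
  obtain m where m: "2 * n = Suc m" using pos by (cases "2 * n") auto
  define r where "r = q @ (y @ q) \<up> m"
  have 2: "a \<approx> a @ y @ r" using 1 by (simp add: m r_def word_power_Suc)
  have "a @ y = (x @ y) \<up> 2" by (simp add: a_def word_power_2)
  also have "\<dots> \<approx> (x @ y) \<up> (n + 2)" by (rule power_law)
  also have "\<dots> = (x @ y) \<up> n @ a @ y" by (simp add: word_power_add a_def word_power_2 del: add_2_eq_Suc')
  finally have 3: "a @ y \<approx> (x @ y) \<up> n @ a @ y" .
  note 2
  also have "a @ y @ r \<approx> (x @ y) \<up> n @ a @ y @ r" using right[OF 3, of r] by simp
  also have "\<dots> \<approx> (x @ y) \<up> n @ a" by (rule left[OF sym[OF 2]])
  also have "\<dots> = (x @ y) \<up> (n + 1) @ x"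
    by (simp add: a_def word_power_Suc_right)
  finally show ?thesis by (simp only: a_def)
qed

text \<open>The Rees quotient by the words that do not divide \<open>xyx\<close> is finite.  As \<open>xyx\<close> itself is not sent to zero in it,
  the identity holds modulo \<open>\<approx>\<close> and not just modulo the larger congruence \<open>Q\<close>.\<close>

lemma xyx_if_bounded:
  assumes bounded: "\<And>w. set w \<subseteq> {0, 1} \<Longrightarrow> w \<approx> [0, 1, 0] \<Longrightarrow> \<not> thrice_01 w"
  shows "[0, 1, 0] \<approx> [0, 1] \<up> (n + 1) @ [0]"
proof -
  define D where "D u \<longleftrightarrow> (\<exists>p q. p @ u @ q \<approx> [0, 1, 0])" for u
  define Q where "Q u v \<longleftrightarrow> u \<approx> v \<or> (\<not> D u \<and> \<not> D v)" for u v
  have D_eqv: "D u \<longleftrightarrow> D v" if "u \<approx> v" for u v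
    unfolding D_def using trans[OF ctx[OF that]] trans[OF ctx[OF sym[OF that]]] by blast
  have D_factor: "D u" if "D (p @ u @ q)" for p u q
    using that unfolding D_def by (metis append_assoc)
  have Q: "congruence Q"
  proof (rule congruenceI)
    show "Q u w" if "Q u v" "Q v w" for u v w
      using that D_eqv trans[of u v w] unfolding Q_def by blast
    show "Q (p @ u @ q) (p @ v @ q)" if "Q u v" for u v p q
      using that ctx[of u v p q] D_factor unfolding Q_def by blast
    show "Q v u" if "Q u v" for u v
      using that sym unfolding Q_def by blast
  qed (simp add: Q_def)
  \<comment> \<open>Words equivalent to \<open>xyx\<close> may contain further letters; \<open>\<kappa>\<close> renames them to \<open>1\<close>.\<close>
  define \<kappa> where "\<kappa> i = (if i = 0 then [0] else [1::nat])" for i :: nat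
  have \<kappa>_id: "subst_word \<kappa> w = w" if "set w \<subseteq> {0, 1}" for w
    using that by (intro subst_word_letters) (auto simp: \<kappa>_def)
  have \<kappa>_set: "set (subst_word \<kappa> w) \<subseteq> {0, 1}" for w
    by (auto simp: set_subst_word \<kappa>_def split: if_splits)
  have D_bounded: "\<not> thrice_01 w" if "set w \<subseteq> {0, 1}" "D w" for w
  proof
    assume T: "thrice_01 w"
    obtain p q where "p @ w @ q \<approx> [0, 1, 0]" using \<open>D w\<close> by (auto simp: D_def)
    from subst[OF this, of \<kappa>]
    have "subst_word \<kappa> p @ w @ subst_word \<kappa> q \<approx> [0, 1, 0]"
      using \<kappa>_id[OF that(1)] by (simp add: \<kappa>_def)
    then show False
      using bounded[of "subst_word \<kappa> p @ w @ subst_word \<kappa> q"] \<kappa>_set that(1) thrice_01_factor[OF T]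
      by simp
  qed
  \<comment> \<open>A representative of the zero of the Rees quotient.\<close>
  define z :: word where "z = [0, 1] \<up> 3"
  have z: "z = [0, 1, 0, 1, 0, 1]" by (simp add: z_def numeral_3_eq_3 word_power_Suc)
  have "thrice_01 z"
    unfolding thrice_01_def z by (intro exI[of _ "[]"]) simp
  then have Dz: "\<not> D z" using D_bounded[of z] z by auto
  define A where "A = {w. set w \<subseteq> {0, 1::nat} \<and> length w \<le> 6 * (n + 1) + 4} - {[]}"
  have A: "finite A" "[] \<notin> A"
    using finite_lists_length_le[of "{0, 1::nat}"] by (auto simp: A_def)
  have cl: "\<exists>c\<in>A. Q (a @ b) c" if ab: "a \<in> A" "b \<in> A" for a b
  proof (cases "D (a @ b)")
    case False
    moreover have "z \<in> A" by (auto simp: A_def z)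
    ultimately show ?thesis using Dz unfolding Q_def by blast
  next
    case True
    have "set (a @ b) \<subseteq> {0, 1}" "a @ b \<noteq> []" using ab by (auto simp: A_def)
    then obtain c where "a @ b \<approx> c" "length c \<le> 6 * (n + 1) + 4" "set c \<subseteq> {0, 1}"
      using short_if_not_thrice_01 D_bounded True by blast
    then show ?thesis using eq_Nil[of "a @ b" c] \<open>a @ b \<noteq> []\<close> by (auto simp: A_def Q_def)
  qed
  have "[0] \<in> A" "[1] \<in> A" by (auto simp: A_def)
  then have "Q ([0] @ [1] @ [0]) (([0] @ [1]) \<up> (n + 1) @ [0])"
    using finite_test[OF Q _ A cl, of "[0]" "[1]"] unfolding Q_def by blast
  moreover have "D [0, 1, 0]" unfolding D_def by (metis append_Nil append_Nil2 refl)
  ultimately show ?thesis by (simp add: Q_def)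
qed

text \<open>A word \<open>w\<close> equivalent to \<open>xyx\<close> with three factors \<open>01\<close> forces \<open>xyxy\<close> to divide \<open>xyx\<close>.  If alternation is invariant,
  \<open>w\<close> is alternating and the factor is visible.  Otherwise, apply the equivalence \<open>xyx \<approx> w\<close> to the
  factor \<open>X Y X\<close> of \<open>w\<close> itself.  Every binary word of length at least four contains a square \<open>r r\<close>, and as both
  \<open>X\<close> and \<open>Y\<close> contain \<open>01\<close>, so does the image of \<open>r\<close>.  The square of this image has an idempotent divisor, which has the divisor \<open>01\<close> and
  therefore, by \<open>idempotent_below_append\<close>, also \<open>0101\<close>.\<close>

lemma xyx_letters: "[0, 1, 0] \<approx> [0, 1] \<up> (n + 1) @ [0]"
proof (cases "\<exists>w. set w \<subseteq> {0, 1} \<and> w \<approx> [0, 1, 0] \<and> thrice_01 w")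
  case False
  then show ?thesis by (intro xyx_if_bounded) blast
next
  case True
  then obtain w p m m' q where w: "set w \<subseteq> {0, 1}" "w \<approx> [0, 1, 0]"
    and w_eq: "w = p @ [0, 1] @ m @ [0, 1] @ m' @ [0, 1] @ q"
    unfolding thrice_01_def by blast
  have "[0, 1, 0] \<preceq> [0, 1] @ [0, 1]"
  proof (cases alternating_invariant)
    case True
    then have "distinct_adj w"
      using w(1) sym[OF w(2)] True[unfolded alternating_invariant_def, rule_format, of "[0, 1, 0]" w]
      by simp
    obtain a b r where r: "m @ [0, 1] @ m' @ [0, 1] @ q = a # b # r"
      by (cases m rule: list.exhaust; cases "tl m") auto
    then have w': "w = p @ [0, 1, a, b] @ r" by (simp add: w_eq)
    have "a = 0 \<and> b = 1"
      using \<open>distinct_adj w\<close> w(1) unfolding w' by (auto simp: distinct_adj_append_iff)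
    then have "[0, 1, 0] \<approx> p @ ([0, 1] @ [0, 1]) @ r"
      using sym[OF w(2)] w' by simp
    then show ?thesis by (rule belowI)
  next
    case H: False
    define Y where "Y = m @ [0, 1] @ m'"
    \<comment> \<open>The substitution that turns \<open>xyx\<close> into the factor \<open>X Y X\<close> of \<open>w\<close>.\<close>
    define \<phi> where "\<phi> i = (if i = 0 then [0, 1] else Y)" for i :: nat
    have \<phi>: "\<phi> i \<noteq> []" "\<exists>s t. \<phi> i = s @ [0, 1] @ t" for i
      by (auto simp: \<phi>_def Y_def intro: exI[of _ "[]"])
    have "length w \<ge> 4" by (simp add: w_eq)
    then obtain s r t where srt: "w = s @ r @ r @ t" "r \<noteq> []"
      using binary_square[OF w(1)] by blast
    define \<rho> where "\<rho> = subst_word \<phi> r"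
    obtain c r' where "r = c # r'" using srt(2) by (cases r) auto
    obtain s' t' where "\<phi> c = s' @ [0, 1] @ t'" using \<phi>(2) by blast
    then have \<rho>: "\<rho> \<preceq> [0, 1]"
      using below_factor[of s' "[0, 1]" "t' @ subst_word \<phi> r'"] by (simp add: \<rho>_def \<open>r = c # r'\<close>)
    have "[0, 1, 0] \<approx> w" by (rule sym[OF w(2)])
    also have "w = p @ subst_word \<phi> [0, 1, 0] @ q" by (simp add: w_eq \<phi>_def Y_def)
    also have "\<dots> \<approx> p @ subst_word \<phi> w @ q" by (intro ctx subst sym[OF w(2)] \<phi>(1))
    also have "\<dots> = (p @ subst_word \<phi> s) @ \<rho> \<up> 2 @ (subst_word \<phi> t @ q)"
      by (simp add: srt(1) \<rho>_def word_power_2)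
    also have "\<dots> \<preceq> \<rho> \<up> 2" by (rule below_factor)
    also have "\<rho> \<up> 2 \<approx> idem \<rho> @ \<rho> \<up> 2" by (intro sym[OF idem_absorb]) simp
    also have "\<dots> \<preceq> idem \<rho>" using below_factor[of "[]"] by simp
    finally have 1: "[0, 1, 0] \<preceq> idem \<rho>" .
    obtain k where "2 * n = Suc k" using pos by (cases "2 * n") auto
    then have "idem \<rho> \<preceq> \<rho>"
      using below_factor[of "[]" \<rho> "\<rho> \<up> k"] by (simp add: word_power_Suc)
    also note \<rho>
    finally have "idem \<rho> \<preceq> [0, 1]" .
    from idempotent_below_append[OF H idem_idem this this] 1 show ?thesis
      by (rule below_trans[rotated])
  qed
  then show ?thesis using xyx_if_below_xyxy[of "[0]" "[1]"] by simp
qed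

lemma xyx_law:
  assumes "x \<noteq> []" "y \<noteq> []"
  shows "x @ y @ x \<approx> (x @ y) \<up> (n + 1) @ x"
  using subst[OF xyx_letters, of "\<lambda>i. if i = 0 then x else y"] assms by simp

end

section \<open>The third identity when alternation is invariant\<close>

text \<open>The letters \<open>0, 1, 2, 3\<close> stand for \<open>x, y, z, h\<close>.  A word is cyclic if it runs through the cycle \<open>x, {y, h}, z\<close>; these are
  the words with a non-zero value in the Brandt semigroup of \<open>3 \<times> 3\<close> matrix units.\<close>

definition phase :: "nat \<Rightarrow> nat" where
  "phase i = (if i = 0 then 0 else if i = 2 then 2 else 1)"

definition consecutive :: "nat \<Rightarrow> nat \<Rightarrow> bool" where
  "consecutive i j \<longleftrightarrow> phase j = (if phase i = 2 then 0 else phase i + 1)"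

lemma phase_letters [simp]: "phase 0 = 0" "phase (Suc 0) = 1" "phase 2 = 2" "phase 3 = 1"
  by (simp_all add: phase_def)

lemma consecutive_letters [simp]:
  "consecutive i 0 \<longleftrightarrow> phase i = 2" "consecutive i (Suc 0) \<longleftrightarrow> phase i = 0"
  "consecutive i 2 \<longleftrightarrow> phase i = 1" "consecutive i 3 \<longleftrightarrow> phase i = 0"
  by (simp_all add: consecutive_def phase_def)

abbreviation cyclic :: "word \<Rightarrow> bool" where
  "cyclic \<equiv> successively consecutive"

text \<open>The matrix units of size three arise inside a square of the Brandt semigroup of size two: with \<open>0\<close> as \<open>e\<^sub>1\<^sub>2\<close> and
  \<open>1\<close> as \<open>e\<^sub>2\<^sub>1\<close> the first map sends the phases to \<open>e\<^sub>1\<^sub>2, e\<^sub>2\<^sub>2, e\<^sub>2\<^sub>1\<close>, the second to \<open>e\<^sub>1\<^sub>1, e\<^sub>1\<^sub>2, e\<^sub>2\<^sub>1\<close>.  Each of the two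
  allows some transitions too many, but the cyclic ones are the only ones allowed by both.\<close>

definition brandt1 :: "nat \<Rightarrow> word" where
  "brandt1 i = (if phase i = 0 then [0] else if phase i = 2 then [1] else [1, 0])"

definition brandt2 :: "nat \<Rightarrow> word" where
  "brandt2 i = (if phase i = 0 then [0, 1] else if phase i = 2 then [1] else [0])"

lemma cyclic_iff_alternating:
  "cyclic w \<longleftrightarrow> distinct_adj (subst_word brandt1 w) \<and> distinct_adj (subst_word brandt2 w)"
proof (induction w rule: induct_list012)
  case (2 a)
  show ?case by (auto simp: brandt1_def brandt2_def)
next
  case (3 a b w)
  then show ?case
    by (auto simp: brandt1_def brandt2_def phase_def consecutive_def split: if_splits)
qed simp

lemma cyclic_split:
  assumes "cyclic w"
  shows "\<exists>p r. w = p @ r \<and> length p \<le> 2 \<and> (r = [] \<or> phase (hd r) = 0)"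
proof (cases w)
  case (Cons c v)
  consider "phase c = 0" | "phase c = 2" | "phase c = 1" unfolding phase_def by presburger
  then show ?thesis
  proof cases
    case 1
    then show ?thesis using Cons by (intro exI[of _ "[]"] exI[of _ w]) simp
  next
    case 2
    then show ?thesis using Cons assms
      by (intro exI[of _ "[c]"] exI[of _ v]) (auto simp: successively_Cons consecutive_def)
  next
    case 3
    then show ?thesis using Cons assms
      by (intro exI[of _ "take 2 w"] exI[of _ "drop 2 w"], cases v)
        (auto simp: successively_Cons consecutive_def)
  qed
qed simp

lemma cyclic_block:
  assumes "cyclic w" "phase (hd w) = 0" "length w \<ge> 3" "set w \<subseteq> {0, 1, 2, 3}"
  shows "\<exists>b v. w = b @ v \<and> b \<in> {[0, 3, 2], [0, 1, 2]} \<and> cyclic v \<and> (v = [] \<or> phase (hd v) = 0)"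
proof -
  obtain c d e v where w: "w = c # d # e # v"
    using assms(3) by (auto simp: numeral_3_eq_3 Suc_le_length_iff)
  have "c = 0" "d = 1 \<or> d = 3" "e = 2" "cyclic v" "v = [] \<or> phase (hd v) = 0"
  proof -
    have c: "c = 0" using assms(2) unfolding w by (simp add: phase_def split: if_splits)
    have "consecutive c d" "consecutive d e" using assms(1) unfolding w by simp_all
    then have d: "phase d = 1" and e: "phase e = 2" by (simp_all add: c consecutive_def)
    show "c = 0" by (rule c)
    show "d = 1 \<or> d = 3" using d assms(4) unfolding w by (auto simp: phase_def)
    show e2: "e = 2" using e by (simp add: phase_def split: if_splits)
    show "cyclic v" "v = [] \<or> phase (hd v) = 0"
      using assms(1) unfolding w e2 by (auto simp: successively_Cons consecutive_def[of 2])
  qed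
  then show ?thesis unfolding w by (intro exI[of _ "[c, d, e]"] exI[of _ v]) auto
qed

lemma cyclic_absorb:
  assumes "b \<in> {[0, 3, 2], [0, 1, 2]}" "c \<in> {[0, 3, 2], [0, 1, 2]}"
  shows "cyclic (p @ (b @ c) @ q) \<longleftrightarrow> cyclic (p @ c @ q)"
  using assms by (elim insertE emptyE) (simp_all add: successively_append_iff)

lemma cyclic_power:
  "cyclic (p @ [0, 1, 2] \<up> Suc k @ q) \<longleftrightarrow> cyclic (p @ [0, 1, 2] @ q)"
proof (induction k)
  case (Suc k)
  have "cyclic (p @ [0, 1, 2] \<up> Suc (Suc k) @ q) \<longleftrightarrow> cyclic (p @ ([0, 1, 2] @ [0, 1, 2]) @ [0, 1, 2] \<up> k @ q)"
    by (simp add: word_power_Suc)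
  also have "\<dots> \<longleftrightarrow> cyclic (p @ [0, 1, 2] @ [0, 1, 2] \<up> k @ q)"
    by (rule cyclic_absorb) simp_all
  finally show ?case using Suc by (simp add: word_power_Suc)
qed simp

context finitely_tested
begin

text \<open>The idempotent \<open>q\<^bsup>2n\<^esup>\<close> replaces \<open>q\<^sup>n\<close>: since \<open>a\<close> begins with \<open>x\<close>, the product \<open>q a\<close> contains \<open>x (h z) x\<close>, so \<open>q a \<approx> q\<^bsup>n+1\<^esup> a\<close>.\<close>

lemma power_n_absorb_left:
  assumes "x \<noteq> []" "h @ z \<noteq> []"
  shows "(x @ h @ z) \<up> n @ x @ y @ z \<approx> idem (x @ h @ z) @ x @ y @ z"
proof -
  let ?q = "x @ h @ z"
  obtain k where k: "n = Suc k" using pos by (cases n) auto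
  have "?q @ x \<approx> ?q \<up> (n + 1) @ x"
    using xyx_law[OF assms] by simp
  from ctx[OF this, of "?q \<up> k" "y @ z"]
  have "?q \<up> n @ x @ y @ z \<approx> ?q \<up> k @ ?q \<up> (n + 1) @ x @ y @ z"
    unfolding k word_power_Suc_right by simp
  also have "\<dots> = ?q \<up> (k + (n + 1)) @ x @ y @ z" unfolding word_power_add by simp
  also have "k + (n + 1) = 2 * n" by (simp add: k)
  finally show ?thesis .
qed

lemma power_n_absorb_right:
  assumes "z \<noteq> []" "x @ h \<noteq> []"
  shows "(x @ y @ z) @ (x @ h @ z) \<up> n \<approx> (x @ y @ z) @ idem (x @ h @ z)"
proof -
  let ?q = "x @ h @ z"
  obtain k where k: "n = Suc k" using pos by (cases n) auto
  have "z @ ?q \<approx> (z @ x @ h) \<up> (n + 1) @ z"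
    using xyx_law[OF assms] by simp
  also have "\<dots> = z @ ?q \<up> (n + 1)"
    using word_power_slide[of z "x @ h" "n + 1"] by simp
  finally have "z @ ?q \<approx> z @ ?q \<up> (n + 1)" .
  from ctx[OF this, of "x @ y" "?q \<up> k"]
  have "(x @ y @ z) @ ?q \<up> n \<approx> (x @ y @ z) @ ?q \<up> (n + 1) @ ?q \<up> k"
    unfolding k word_power_Suc by simp
  also have "\<dots> = (x @ y @ z) @ ?q \<up> (n + 1 + k)" unfolding word_power_add by simp
  also have "n + 1 + k = 2 * n" by (simp add: k)
  finally show ?thesis .
qed

text \<open>The substitution \<open>\<psi>\<close> modifies \<open>h\<close> and \<open>y\<close> so that \<open>q\<close> becomes the idempotent \<open>e\<close> and \<open>a\<close> becomes \<open>e a\<close>.  The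
  congruence \<open>Q\<close> compares the \<open>\<psi>\<close>-images of cyclic words and identifies all others; demanding this in
  every context \<open>p \<dots> r\<close> makes it a congruence by construction, and invariance of alternation puts it above \<open>\<approx>\<close>.
  A cyclic word is a product of factors \<open>q\<close> and \<open>a\<close>, apart from its ends, and \<open>q\<close> is absorbed by
  whatever factor follows it, so that the words \<open>p a\<^sup>k s\<close> with bounded \<open>k\<close> and short \<open>p\<close> and \<open>s\<close> represent all classes.\<close>

lemma absorb_if_alternating_invariant:
  assumes inv: alternating_invariant
  shows "idem [0, 3, 2] @ [0, 1, 2] \<approx> idem [0, 3, 2] @ [0, 1, 2] @ idem [0, 3, 2]"
proof -
  define q :: word where "q = [0, 3, 2]"
  define a :: word where "a = [0, 1, 2]"
  define e where "e = idem q"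
  obtain m where m: "2 * n = Suc m" using pos by (cases "2 * n") auto
  \<comment> \<open>Chosen so that \<open>x h' z = (x h z)\<^bsup>2n\<^esup>\<close>.\<close>
  define h' :: word where "h' = [3] @ [2, 0, 3] \<up> m"
  define \<psi> where "\<psi> i = (if i = 1 then h' @ [2, 0, 1] else if i = 3 then h' else [i])" for i
  have \<psi>: "\<psi> i \<noteq> []" for i by (simp add: \<psi>_def h'_def)
  have "e = [0, 3] @ ([2] @ [0, 3]) \<up> m @ [2]"
    using word_power_rotate[of "[0, 3]" "[2]" m] by (simp add: e_def q_def m)
  then have \<psi>q: "subst_word \<psi> q = e" and \<psi>a: "subst_word \<psi> a = e @ a"
    by (simp_all add: q_def a_def \<psi>_def h'_def)
  have ee: "e @ e \<approx> e" unfolding e_def by (rule idem_idem)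
  have eea: "e @ e @ a \<approx> e @ a" using right[OF ee, of a] by simp

  have cyclic_eqv: "cyclic u \<longleftrightarrow> cyclic v" if "u \<approx> v" for u v
  proof -
    have *: "distinct_adj (subst_word \<phi> u) \<longleftrightarrow> distinct_adj (subst_word \<phi> v)"
      if "\<And>i. \<phi> i \<noteq> [] \<and> set (\<phi> i) \<subseteq> {0, 1}" for \<phi>
    proof -
      have "set (subst_word \<phi> w) \<subseteq> {0, 1}" for w
        using that by (force simp: set_subst_word)
      moreover have "subst_word \<phi> u \<approx> subst_word \<phi> v"
        using subst[OF \<open>u \<approx> v\<close>, of \<phi>] that by simp
      ultimately show ?thesis
        using inv sym[of "subst_word \<phi> u" "subst_word \<phi> v"] unfolding alternating_invariant_def by blast
    qed
    show ?thesis
      unfolding cyclic_iff_alternating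
      by (intro arg_cong2[where f = "(\<and>)"] *) (simp_all add: brandt1_def brandt2_def)
  qed

  define Q where "Q u v \<longleftrightarrow> (\<forall>p r. (cyclic (p @ u @ r) \<longleftrightarrow> cyclic (p @ v @ r)) \<and>
      (cyclic (p @ u @ r) \<longrightarrow> subst_word \<psi> (p @ u @ r) \<approx> subst_word \<psi> (p @ v @ r)))" for u v
  have Q_trans: "Q u w" if "Q u v" "Q v w" for u v w
    unfolding Q_def
  proof (intro allI conjI impI)
    fix p r
    note uv = that(1)[unfolded Q_def, rule_format, of p r] and vw = that(2)[unfolded Q_def, rule_format, of p r]
    from uv vw show "cyclic (p @ u @ r) \<longleftrightarrow> cyclic (p @ w @ r)" by blast
    assume u: "cyclic (p @ u @ r)"
    with uv have "cyclic (p @ v @ r)" by blast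
    from trans[OF conjunct2[OF uv, rule_format, OF u] conjunct2[OF vw, rule_format, OF this]]
    show "subst_word \<psi> (p @ u @ r) \<approx> subst_word \<psi> (p @ w @ r)" .
  qed
  have Q_ctx: "Q (p @ u @ r) (p @ v @ r)" if "Q u v" for u v p r
    unfolding Q_def
  proof (intro allI)
    fix p' r'
    show "(cyclic (p' @ (p @ u @ r) @ r') \<longleftrightarrow> cyclic (p' @ (p @ v @ r) @ r')) \<and>
      (cyclic (p' @ (p @ u @ r) @ r') \<longrightarrow>
        subst_word \<psi> (p' @ (p @ u @ r) @ r') \<approx> subst_word \<psi> (p' @ (p @ v @ r) @ r'))"
      using that[unfolded Q_def, rule_format, of "p' @ p" "r @ r'"] by simp
  qed
  have Q: "congruence Q"
  proof (rule congruenceI)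
    show "Q u u" for u by (simp add: Q_def)
    show "Q v u" if "Q u v" for u v
      using that sym[of "subst_word \<psi> _" "subst_word \<psi> _"] unfolding Q_def by blast
  qed (fact Q_trans Q_ctx)+
  have eqv_Q: "Q u v" if "u \<approx> v" for u v
    unfolding Q_def by (intro allI conjI impI cyclic_eqv subst ctx that \<psi>)
  have Q_refl: "Q u u" for u using eqv_Q by simp
  have Q_left: "Q (p @ u) (p @ v)" and Q_right: "Q (u @ p) (v @ p)" if "Q u v" for u v p
    using Q_ctx[OF that, of p "[]"] Q_ctx[OF that, of "[]" p] by simp_all

  have Q_absorb: "Q (q @ b) b" if "b \<in> {q, a}" for b
    unfolding Q_def
  proof (intro allI conjI impI)
    fix p r
    show "cyclic (p @ (q @ b) @ r) \<longleftrightarrow> cyclic (p @ b @ r)"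
      using that unfolding q_def a_def by (intro cyclic_absorb) auto
    have "e @ subst_word \<psi> b \<approx> subst_word \<psi> b"
      using that \<psi>q \<psi>a ee eea by auto
    then show "subst_word \<psi> (p @ (q @ b) @ r) \<approx> subst_word \<psi> (p @ b @ r)"
      using ctx[of "e @ subst_word \<psi> b" "subst_word \<psi> b"] by (simp add: \<psi>q)
  qed
  have Q_power: "Q (a \<up> (n + 2)) (a \<up> 2)"
    unfolding Q_def
  proof (intro allI conjI impI)
    fix p r
    show "cyclic (p @ a \<up> (n + 2) @ r) \<longleftrightarrow> cyclic (p @ a \<up> 2 @ r)"
      using cyclic_power[of p "n + 1" r] cyclic_power[of p 1 r]
      by (simp add: a_def numeral_2_eq_2)
    show "subst_word \<psi> (p @ a \<up> (n + 2) @ r) \<approx> subst_word \<psi> (p @ a \<up> 2 @ r)"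
      using ctx[OF sym[OF power_law[of "subst_word \<psi> a"]]] by simp
  qed

  have normal: "\<exists>k s. k \<le> n + 1 \<and> length s \<le> 5 \<and> set s \<subseteq> {0, 1, 2, 3} \<and> Q w (a \<up> k @ s)"
    if "set w \<subseteq> {0, 1, 2, 3}" "cyclic w" "w = [] \<or> phase (hd w) = 0" for w
    using that
  proof (induction w rule: length_induct)
    case (1 w)
    show ?case
    proof (cases "length w \<ge> 3")
      case False
      then show ?thesis using 1(2) Q_refl by (intro exI[of _ 0] exI[of _ w]) simp
    next
      case True
      then have "phase (hd w) = 0" using 1(4) by auto
      then obtain b v where w: "w = b @ v" and b: "b \<in> {q, a}" and v: "cyclic v" "v = [] \<or> phase (hd v) = 0"
        using cyclic_block[OF 1(3) _ True 1(2)] unfolding q_def a_def by blast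
      have "length v < length w" using b by (auto simp: w q_def a_def)
      moreover have "set v \<subseteq> {0, 1, 2, 3}" using 1(2) by (simp add: w)
      ultimately obtain k s where ks: "k \<le> n + 1" "length s \<le> 5" "set s \<subseteq> {0, 1, 2, 3}" "Q v (a \<up> k @ s)"
        using 1(1)[rule_format, of v] v by blast
      have Qw: "Q w (b @ a \<up> k @ s)" unfolding w by (rule Q_left[OF ks(4)])
      show ?thesis
      proof (cases "b = a")
        case True
        then have Qw: "Q w (a \<up> Suc k @ s)" using Qw by (simp add: word_power_Suc)
        show ?thesis
        proof (cases "k \<le> n")
          case True
          then show ?thesis using Qw ks(2,3) by (intro exI[of _ "Suc k"] exI[of _ s]) simp
        next
          case False
          then have "Suc k = n + 2" using ks(1) by simp
          then have "Q w (a \<up> 2 @ s)" using Q_trans[OF Qw] Q_right[OF Q_power] by simp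
          then show ?thesis using ks(2,3) pos by (intro exI[of _ 2] exI[of _ s]) simp
        qed
      next
        case False
        then have Qw: "Q w (q @ a \<up> k @ s)" using Qw b by simp
        show ?thesis
        proof (cases k)
          case (Suc l)
          have "Q (q @ a \<up> k @ s) (a \<up> k @ s)"
            using Q_right[OF Q_absorb[of a], of "a \<up> l @ s"] by (simp add: Suc word_power_Suc)
          then show ?thesis using Q_trans[OF Qw] ks by blast
        next
          case 0
          then have Qw: "Q w (q @ s)" and Qv: "Q v s" using Qw ks(4) by simp_all
          show ?thesis
          proof (cases "length s \<ge> 3")
            case False
            then show ?thesis using Qw ks(3)
              by (intro exI[of _ 0] exI[of _ "q @ s"]) (simp add: q_def)
          next
            case True
            have "cyclic s" using Qv[unfolded Q_def, rule_format, of "[]" "[]"] v(1) by simp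
            moreover have "cyclic ([2] @ v @ [])"
              using v by (auto simp: successively_Cons consecutive_def[of 2])
            then have "cyclic ([2] @ s @ [])" using Qv unfolding Q_def by blast
            then have "phase (hd s) = 0"
              using True by (auto simp: successively_Cons consecutive_def[of 2])
            ultimately obtain c t where "s = c @ t" "c \<in> {q, a}"
              using cyclic_block[of s] True ks(3) unfolding q_def a_def by blast
            then have "Q (q @ s) s" using Q_right[OF Q_absorb[of c], of t] by simp
            then have "Q w s" by (rule Q_trans[OF Qw])
            then show ?thesis using ks(2,3) by (intro exI[of _ 0] exI[of _ s]) simp
          qed
        qed
      qed
    qed
  qed

  define A where "A = {w. set w \<subseteq> {0, 1, 2, 3::nat} \<and> length w \<le> 3 * n + 10} - {[]}"
  have A: "finite A" "[] \<notin> A"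
    using finite_lists_length_le[of "{0, 1, 2, 3::nat}"] by (auto simp: A_def)
  have cl: "\<exists>c\<in>A. Q (u @ v) c" if uv: "u \<in> A" "v \<in> A" for u v
  proof (cases "cyclic (u @ v)")
    case False
    \<comment> \<open>The word \<open>00\<close> is not cyclic and represents the zero of the quotient.\<close>
    have "\<not> cyclic (p @ (u @ v) @ r)" "\<not> cyclic (p @ [0, 0] @ r)" for p r
      using False by (simp_all only: successively_append_iff[of _ p] successively_append_iff[of _ "u @ v" r]
        successively_append_iff[of _ "[0, 0]" r]) simp_all
    then have "Q (u @ v) [0, 0]" unfolding Q_def by blast
    then show ?thesis by (auto simp: A_def intro!: bexI[of _ "[0, 0]"])
  next
    case True
    then obtain p r where pr: "u @ v = p @ r" "length p \<le> 2" "r = [] \<or> phase (hd r) = 0"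
      using cyclic_split by blast
    have "set (p @ r) \<subseteq> {0, 1, 2, 3}" using uv unfolding pr(1)[symmetric] by (auto simp: A_def)
    moreover have "cyclic r" using True by (auto simp: pr(1) successively_append_iff)
    ultimately obtain k s where ks: "k \<le> n + 1" "length s \<le> 5" "set s \<subseteq> {0, 1, 2, 3}" "Q r (a \<up> k @ s)"
      using normal[of r] pr(3) by auto
    have Quv: "Q (u @ v) (p @ a \<up> k @ s)" unfolding pr(1) by (rule Q_left[OF ks(4)])
    have "subst_word \<psi> (u @ v) \<approx> subst_word \<psi> (p @ a \<up> k @ s)"
      using Quv[unfolded Q_def, rule_format, of "[]" "[]"] True by simp
    moreover have "subst_word \<psi> (u @ v) \<noteq> []"
      using uv(1) \<psi> by (cases u) (auto simp: A_def)
    ultimately have "p @ a \<up> k @ s \<noteq> []" using eq_Nil by fastforce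
    moreover have "length (p @ a \<up> k @ s) \<le> 3 * n + 10"
      using pr(2) ks(1,2) by (simp add: a_def)
    moreover have "set (p @ a \<up> k @ s) \<subseteq> {0, 1, 2, 3}"
      using \<open>set (p @ r) \<subseteq> _\<close> ks(3) set_word_power[of a k] by (auto simp: a_def)
    ultimately show ?thesis using Quv unfolding A_def by blast
  qed
  have "[0] \<in> A" "[1] \<in> A" "[2] \<in> A" "[3] \<in> A" by (auto simp: A_def)
  from finite_test[OF Q eqv_Q A cl this]
  have "Q (q \<up> n @ a) (a @ q \<up> n)" by (simp add: q_def a_def)
  moreover have "cyclic (q \<up> k @ a)" for k
  proof (induction k)
    case (Suc k)
    show ?case
    proof (cases k)
      case (Suc l)
      then show ?thesis
        using \<open>cyclic (q \<up> k @ a)\<close> cyclic_absorb[of q q "[]" "q \<up> l @ a"]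
        by (simp add: word_power_Suc q_def)
    qed (simp add: q_def a_def consecutive_def phase_def)
  qed (simp add: a_def consecutive_def phase_def)
  ultimately have "e \<up> n @ e @ a \<approx> e @ a @ e \<up> n"
    using \<psi>q \<psi>a unfolding Q_def by (auto dest!: spec[of _ "[]"])
  moreover obtain k where "n = Suc k" using pos by (cases n) auto
  then have en: "e \<up> n \<approx> e" using idempotent_power[OF ee] by simp
  ultimately have "e \<up> n @ e @ a \<approx> e @ a @ e"
    using trans[OF _ left[OF en, of "e @ a"]] by simp
  moreover have "e \<up> n @ e @ a \<approx> e @ a"
    using trans[OF right[OF en, of "e @ a"] eea] .
  ultimately have "e @ a \<approx> e @ a @ e"
    using trans[OF sym[of "e \<up> n @ e @ a" "e @ a"]] by simp
  then show ?thesis by (simp add: e_def q_def a_def)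
qed

end

section \<open>The third identity when alternation is not invariant\<close>

context finitely_tested
begin

lemma idem_eq_Suc: obtains m where "2 * n = Suc m"
  using pos by (cases "2 * n") auto

lemma below_Nil: "g \<preceq> []"
  by (rule belowI[of g g "[]" "[]"]) simp

lemma idem_below: "idem w \<preceq> w"
proof -
  obtain m where m: "2 * n = Suc m" by (rule idem_eq_Suc)
  show ?thesis unfolding m word_power_Suc using below_factor[of "[]" w "w \<up> m"] by simp
qed

lemma square_below_idem: "w @ w \<preceq> idem w"
proof -
  have "w @ w = w \<up> 2" by (simp add: word_power_2)
  also have "\<dots> \<approx> idem w @ w \<up> 2" by (intro sym[OF idem_absorb]) simp
  also have "\<dots> \<preceq> idem w" using below_factor[of "[]"] by simp
  finally show ?thesis .
qed

lemma idempotent_below_power: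
  assumes "\<not> alternating_invariant" "g @ g \<approx> g" "g \<preceq> u"
  shows "g \<preceq> u \<up> k"
  by (induction k) (simp_all add: word_power_Suc below_Nil idempotent_below_append assms)

text \<open>As \<open>g\<close> has \<open>g\<close> and \<open>k\<close> as divisors, it has the divisor \<open>g k g\<close>, which thus generates the same
  ideal as \<open>g\<close>.  It also lies in a subgroup of the local monoid at \<open>g\<close>, and by stability the identity of that subgroup can only be \<open>g\<close>.\<close>

lemma idempotent_sandwich:
  assumes H: "\<not> alternating_invariant" and g: "g @ g \<approx> g" "g \<noteq> []" and k: "g \<preceq> k"
  shows "g \<approx> idem (g @ k @ g)"
proof -
  define r where "r = g @ k @ g"
  obtain m where m: "2 * n = Suc m" by (rule idem_eq_Suc)
  have gr: "g @ r \<approx> r" using right[OF g(1), of "k @ g"] by (simp add: r_def)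
  have rg: "r @ g \<approx> r" using left[OF g(1), of "g @ k"] by (simp add: r_def)
  have "g \<preceq> g @ k @ g"
    using idempotent_below_append[OF H g(1) _ idempotent_below_append[OF H g(1) k]] below_refl by blast
  then have "g \<preceq> r" by (simp add: r_def)
  also have "r \<approx> r \<up> (n + 1)" by (rule local_group[OF g(2,1) gr rg])
  also have "\<dots> \<approx> r \<up> (n + 1 + n * 1)" using pos by (intro sym[OF power_reduce]) simp
  also have "n + 1 + n * 1 = Suc (2 * n)" by simp
  also have "r \<up> Suc (2 * n) \<preceq> idem r"
    unfolding word_power_Suc using below_factor[of r _ "[]"] by simp
  finally obtain p q where pq: "g \<approx> p @ idem r @ q" by (auto simp: below_def)
  have g_idem: "g @ idem r \<approx> idem r"
    using right[OF gr] by (simp add: m word_power_Suc)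
  have idem_g: "idem r @ g \<approx> idem r"
    using left[OF rg, of "r \<up> m"] by (simp add: m word_power_Suc_right)
  have "p @ g @ idem r @ q \<approx> p @ idem r @ q"
    using ctx[OF g_idem, of p q] by simp
  then have "g \<approx> p @ g @ (idem r @ q)" by (rule trans[OF pq sym])
  from stable(2)[OF this] have "g \<approx> g @ idem (idem r @ q)" .
  also have "\<dots> = (g @ idem r) @ q @ (idem r @ q) \<up> m" by (simp only: m word_power_Suc append_assoc)
  also have "\<dots> \<approx> idem r @ q @ (idem r @ q) \<up> m" by (rule right[OF g_idem])
  finally obtain s where s: "g \<approx> idem r @ s" by blast
  note s
  also have "idem r @ s \<approx> (idem r @ idem r) @ s" by (rule right[OF sym[OF idem_idem]])
  also have "\<dots> = idem r @ idem r @ s" by simp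
  also have "\<dots> \<approx> idem r @ g" by (rule left[OF sym[OF s]])
  also note idem_g
  finally show ?thesis by (simp only: r_def)
qed

lemma xyx_law_idem:
  assumes "x \<noteq> []" "y \<noteq> []"
  shows "x @ y @ x \<approx> (x @ y) \<up> (2 * n + 1) @ x"
proof -
  have "(x @ y) \<up> (n + 1 + n * 1) \<approx> (x @ y) \<up> (n + 1)"
    using pos by (intro power_reduce) simp
  also have "n + 1 + n * 1 = 2 * n + 1" by simp
  finally show ?thesis
    using trans[OF xyx_law[OF assms] right[OF sym]] by blast
qed

text \<open>With \<open>m = zx\<close> and \<open>k\<close> the idempotent power of \<open>m\<close>, the second identity inserts the idempotents \<open>i\<close> and \<open>j\<close> of \<open>hm\<close> and
  \<open>my\<close> into \<open>x h m y z\<close> on the two sides of \<open>h\<close>.  Both have \<open>m\<close>, hence \<open>k\<close>, as a divisor and can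
  be written as \<open>i = U k i\<close> and \<open>j = j k V\<close>.  This exposes the factor \<open>c = k i h j k\<close>, which lies in the local
  monoid at \<open>k\<close> and therefore in a group.\<close>

lemma xhzxyz_below_square:
  assumes H: "\<not> alternating_invariant" and ne: "x \<noteq> []" "h \<noteq> []" "z \<noteq> []" "y \<noteq> []"
  obtains c where "x @ h @ z @ x @ y @ z \<preceq> c @ c"
    and "set x \<union> set h \<union> set z \<union> set y \<subseteq> set c"
proof -
  define m where "m = z @ x"
  define k where "k = idem m"
  define i where "i = idem (h @ m)"
  define j where "j = idem (m @ y)"
  obtain l where l: "2 * n = Suc l" by (rule idem_eq_Suc)
  have kk: "k @ k \<approx> k" and ii: "i @ i \<approx> i" and jj: "j @ j \<approx> j"
    unfolding k_def i_def j_def by (rule idem_idem)+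
  have nonempty: "k \<noteq> []" "i \<noteq> []" "j \<noteq> []" using ne pos by (simp_all add: k_def i_def j_def m_def)
  have "i \<preceq> m"
    using below_trans[OF idem_below below_factor[of h m "[]"]] by (simp add: i_def)
  then have ik: "i \<preceq> k" unfolding k_def by (rule idempotent_below_power[OF H ii])
  have "j \<preceq> m"
    using below_trans[OF idem_below below_factor[of "[]" m y]] by (simp add: j_def)
  then have jk: "j \<preceq> k" unfolding k_def by (rule idempotent_below_power[OF H jj])

  define U where "U = (i @ k @ i) \<up> l @ i"
  have U: "i \<approx> U @ k @ i"
    using idempotent_sandwich[OF H ii nonempty(2) ik] by (simp add: U_def l word_power_Suc_right)
  define V where "V = j @ (j @ k @ j) \<up> l"
  have V: "j \<approx> j @ k @ V"
    using idempotent_sandwich[OF H jj nonempty(3) jk] by (simp add: V_def l word_power_Suc)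

  have xi: "x @ h @ m \<approx> x @ i @ h @ m"
  proof -
    have "x @ h @ m \<approx> (x @ h @ z) \<up> (2 * n + 1) @ x"
      using xyx_law_idem[of x "h @ z"] ne by (simp add: m_def)
    also have "\<dots> = x @ (h @ m) \<up> (2 * n + 1)"
      using word_power_slide[of x "h @ z" "2 * n + 1"] by (simp add: m_def)
    also have "\<dots> = x @ i @ h @ m" unfolding word_power_add i_def by simp
    finally show ?thesis .
  qed
  have jz: "m @ y @ z \<approx> j @ m @ y @ z"
  proof -
    have "m @ y @ z \<approx> (m @ y) \<up> (2 * n + 1) @ z"
      using xyx_law_idem[of z "x @ y"] ne by (simp add: m_def)
    also have "\<dots> = j @ m @ y @ z" unfolding word_power_add j_def by simp
    finally show ?thesis .
  qed
  define c where "c = k @ i @ h @ j @ k"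
  have "x @ h @ m @ y @ z \<approx> x @ i @ h @ m @ y @ z"
    using right[OF xi, of "y @ z"] by simp
  also have "\<dots> \<approx> x @ i @ h @ j @ m @ y @ z"
    using left[OF jz, of "x @ i @ h"] by simp
  also have "\<dots> \<approx> x @ (U @ k @ i) @ h @ j @ m @ y @ z"
    by (intro left right U)
  also have "\<dots> \<approx> x @ (U @ k @ i) @ h @ (j @ k @ V) @ m @ y @ z"
    by (intro left right V)
  also have "\<dots> = (x @ U) @ c @ (V @ m @ y @ z)" by (simp add: c_def)
  also have "\<dots> \<preceq> c" by (rule below_factor)
  also have "c \<approx> c \<up> (n + 1)"
  proof (rule local_group[OF nonempty(1) kk])
    show "k @ c \<approx> c" using right[OF kk, of "i @ h @ j @ k"] by (simp add: c_def)
    show "c @ k \<approx> c" using left[OF kk, of "k @ i @ h @ j"] by (simp add: c_def)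
  qed
  also have "c \<up> (n + 1) = [] @ (c @ c) @ c \<up> (n - 1)"
    using pos by (cases n) (simp_all add: word_power_Suc)
  also have "\<dots> \<preceq> c @ c" by (rule below_factor)
  finally have "x @ h @ z @ x @ y @ z \<preceq> c @ c" by (simp add: m_def)
  moreover have "set x \<union> set h \<union> set z \<union> set y \<subseteq> set c"
  proof -
    have "set j = set (m @ y)" unfolding j_def using pos by (intro set_word_power_pos) simp
    then show ?thesis by (auto simp: c_def m_def)
  qed
  ultimately show thesis by (rule that)
qed

text \<open>The words over \<open>\<Sigma>\<close> that represent elements of the minimal ideal of the semigroup generated by \<open>\<Sigma>\<close>;
  there are none if that semigroup has no minimal ideal.\<close>

definition kernel :: "nat set \<Rightarrow> word set" where
  "kernel \<Sigma> = {w. set w \<subseteq> \<Sigma> \<and> w \<noteq> [] \<and> (\<forall>v. set v \<subseteq> \<Sigma> \<longrightarrow> w \<preceq> v)}"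

lemma kernel_append:
  assumes "w \<in> kernel \<Sigma>" "set p \<subseteq> \<Sigma>" "set q \<subseteq> \<Sigma>"
  shows "p @ w @ q \<in> kernel \<Sigma>"
  using assms below_trans[OF below_factor[of p w q]] by (auto simp: kernel_def)

lemma kernel_appendL: "w \<in> kernel \<Sigma> \<Longrightarrow> set p \<subseteq> \<Sigma> \<Longrightarrow> p @ w \<in> kernel \<Sigma>"
  using kernel_append[of w \<Sigma> p "[]"] by simp

lemma kernel_appendR: "w \<in> kernel \<Sigma> \<Longrightarrow> set q \<subseteq> \<Sigma> \<Longrightarrow> w @ q \<in> kernel \<Sigma>"
  using kernel_append[of w \<Sigma> "[]" q] by simp

text \<open>Multiplying a kernel element by \<open>s\<close> on the left can be undone: by periodicity the minimal ideal is a
  union of minimal left ideals.\<close>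

lemma kernel_left_factor:
  assumes "a \<in> kernel \<Sigma>" "set s \<subseteq> \<Sigma>"
  obtains r where "a \<approx> r @ s @ a"
proof -
  obtain l where l: "2 * n = Suc l" by (rule idem_eq_Suc)
  have "set (s @ a) \<subseteq> \<Sigma>" using assms by (auto simp: kernel_def)
  then obtain p q where "a \<approx> p @ (s @ a) @ q"
    using assms(1) unfolding kernel_def below_def by blast
  then have "a \<approx> (p @ s) @ a @ q" by simp
  from stable(1)[OF this] have "a \<approx> ((p @ s) \<up> l @ p) @ s @ a"
    by (simp add: l word_power_Suc_right)
  then show thesis by (rule that)
qed

text \<open>The square found above is divisible by an idempotent whose word contains all letters, and the divisors of
  an idempotent are closed under concatenation.\<close>

lemma xhzxyz_in_kernel:
  assumes H: "\<not> alternating_invariant" and ne: "x \<noteq> []" "h \<noteq> []" "z \<noteq> []" "y \<noteq> []"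
  shows "x @ h @ z @ x @ y @ z \<in> kernel (set x \<union> set h \<union> set z \<union> set y)"
proof -
  obtain c where c: "x @ h @ z @ x @ y @ z \<preceq> c @ c" "set x \<union> set h \<union> set z \<union> set y \<subseteq> set c"
    by (rule xhzxyz_below_square[OF H ne])
  have letter: "idem c \<preceq> [a]" if "a \<in> set c" for a
  proof -
    from split_list[OF that] obtain p q where "c = p @ [a] @ q" by auto
    then have "c \<preceq> [a]" using below_factor by metis
    with idem_below show ?thesis by (rule below_trans)
  qed
  have "idem c \<preceq> v" if "set v \<subseteq> set c" for v
    using that
  proof (induction v)
    case (Cons a v)
    then have "idem c \<preceq> [a] @ v"
      by (intro idempotent_below_append[OF H idem_idem] letter) auto
    then show ?case by simp
  qed (rule below_Nil)
  then have "x @ h @ z @ x @ y @ z \<preceq> v" if "set v \<subseteq> set x \<union> set h \<union> set z \<union> set y" for v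
    using below_trans[OF c(1) below_trans[OF square_below_idem[of c], of v]] that c(2) by auto
  then show ?thesis using ne by (auto simp: kernel_def)
qed

text \<open>The word \<open>cuc\<close> is fixed by right multiplication by the idempotent \<open>k\<close> of \<open>uc\<close>.  Hence \<open>w c u c\<close> and
  \<open>w' c u c\<close> give rise to elements of the local monoid at \<open>k\<close> inside the minimal ideal.  By \<open>local_idempotent\<close> such
  elements divide each other from the right, so both words generate the same left ideal, whatever \<open>w\<close> and \<open>w'\<close> are.\<close>

lemma return_word_constant:
  assumes w: "w \<in> kernel \<Sigma>" "w' \<in> kernel \<Sigma>" and u: "set ([c] @ u @ [c]) \<subseteq> \<Sigma>"
  shows "\<exists>s. w @ [c] @ u @ [c] \<approx> s @ w' @ [c] @ u @ [c]"
proof -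
  obtain l where l: "2 * n = Suc l" by (rule idem_eq_Suc)
  define k where "k = idem (u @ [c])"
  have kk: "k @ k \<approx> k" and "k \<noteq> []" using idem_idem pos by (simp_all add: k_def)
  have k_set: "set k \<subseteq> \<Sigma>" using u set_word_power[of "u @ [c]" "2 * n"] by (auto simp: k_def)
  have fix_k: "[c] @ u @ [c] \<approx> ([c] @ u @ [c]) @ k"
  proof -
    have slide: "([c] @ u) \<up> Suc i @ [c] = [c] @ (u @ [c]) \<up> Suc i" for i
      by (rule word_power_slide)
    show ?thesis
    proof (cases "u = []")
      case True
      have "[c] \<up> (2 + n * 2) \<approx> [c] \<up> 2" by (intro power_reduce) simp
      moreover have "n * 2 = 2 * n" by simp
      ultimately have "[c] \<up> 2 @ k \<approx> [c] \<up> 2" using True by (simp only: word_power_add k_def append_Nil)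
      from sym[OF this] show ?thesis using True by (simp add: word_power_2)
    next
      case False
      then have "[c] @ u @ [c] \<approx> ([c] @ u) \<up> (2 * n + 1) @ [c]"
        by (intro xyx_law_idem) simp_all
      also have "\<dots> = [c] @ (u @ [c]) \<up> (2 * n + 1)" by (rule word_power_slide)
      also have "2 * n + 1 = Suc (2 * n)" by simp
      finally show ?thesis unfolding word_power_Suc k_def by simp
    qed
  qed
  define a where "a = w @ [c] @ u @ [c]"
  define b where "b = w' @ [c] @ u @ [c]"
  have ak: "a @ k \<approx> a" and bk: "b @ k \<approx> b"
    using left[OF sym[OF fix_k]] by (simp_all add: a_def b_def)
  have a: "a \<in> kernel \<Sigma>" and b: "b \<in> kernel \<Sigma>"
    unfolding a_def b_def using kernel_appendR[OF _ u] w by auto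
  define f where "f = idem (k @ b @ k)"
  define y where "y = k @ a @ k"
  have fyf: "f @ y \<approx> f @ y @ f"
  proof (rule local_idempotent[OF \<open>k \<noteq> []\<close> kk])
    show "f \<noteq> []" using \<open>k \<noteq> []\<close> pos by (simp add: f_def)
    show "f @ f \<approx> f" unfolding f_def by (rule idem_idem)
    show "k @ f \<approx> f"
      using right[OF kk, of "b @ k @ (k @ b @ k) \<up> l"] by (simp add: f_def l word_power_Suc)
    show "f @ k \<approx> f"
      using left[OF kk, of "(k @ b @ k) \<up> l @ k @ b"] by (simp add: f_def l word_power_Suc_right)
    show "k @ y \<approx> y" using right[OF kk, of "a @ k"] by (simp add: y_def)
    show "y @ k \<approx> y" using left[OF kk, of "k @ a"] by (simp add: y_def)
  qed
  have "set (f @ k) \<subseteq> \<Sigma>"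
    using b k_set set_word_power[of "k @ b @ k" "2 * n"] by (auto simp: f_def kernel_def)
  then obtain r where r: "a \<approx> r @ (f @ k) @ a" by (rule kernel_left_factor[OF a])
  define t where "t = r @ f @ y @ (k @ b @ k) \<up> l @ k"
  note r
  also have "r @ (f @ k) @ a \<approx> r @ (f @ k) @ a @ k" by (intro left sym[OF ak])
  also have "\<dots> = r @ f @ y" by (simp add: y_def)
  also have "\<dots> \<approx> r @ f @ y @ f" by (rule left[OF fyf])
  also have "\<dots> = t @ b @ k" by (simp add: t_def f_def l word_power_Suc_right)
  also have "\<dots> \<approx> t @ b" by (rule left[OF bk])
  finally show ?thesis by (auto simp: a_def b_def)
qed

text \<open>The congruence \<open>Q\<close> identifies words that act in the same way, from the right, on the minimal left ideals.  A word of
  length greater than five over four letters has a suffix of length five, that suffix contains a factor \<open>cuc\<close>, and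
  so it already determines the action.  Hence the action is finite and satisfies the third
  identity: \<open>q\<^sup>n a\<close> lies in the left ideal generated by \<open>a q\<^sup>n\<close>, on which \<open>e\<close> acts trivially from the right.\<close>

lemma absorb_if_not_alternating_invariant:
  assumes H: "\<not> alternating_invariant"
  shows "idem [0, 3, 2] @ [0, 1, 2] \<approx> idem [0, 3, 2] @ [0, 1, 2] @ idem [0, 3, 2]"
proof -
  define \<Sigma> :: "nat set" where "\<Sigma> = {0, 1, 2, 3}"
  define q :: word where "q = [0, 3, 2]"
  define a :: word where "a = [0, 1, 2]"
  define K where "K = kernel \<Sigma>"
  \<comment> \<open>Foreign letters are renamed, since the kernel is only a minimal ideal for words over \<open>\<Sigma>\<close>.\<close>
  define \<kappa> where "\<kappa> i = (if i \<in> \<Sigma> then [i] else [0])" for i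
  have \<kappa>: "\<kappa> i \<noteq> []" for i by (simp add: \<kappa>_def)
  have \<kappa>_set: "set (subst_word \<kappa> w) \<subseteq> \<Sigma>" for w
    by (auto simp: set_subst_word \<kappa>_def \<Sigma>_def split: if_splits)
  have \<kappa>_id: "subst_word \<kappa> w = w" if "set w \<subseteq> \<Sigma>" for w
    using that by (intro subst_word_letters) (auto simp: \<kappa>_def)
  \<comment> \<open>The left ideal generated by \<open>w u\<close> lies in the one generated by \<open>w v\<close>, for every kernel word \<open>w\<close>.\<close>
  define P where "P u v \<longleftrightarrow> (\<forall>w\<in>K. \<exists>s. w @ subst_word \<kappa> u \<approx> s @ w @ subst_word \<kappa> v)" for u v
  define Q where "Q u v \<longleftrightarrow> P u v \<and> P v u" for u v
  have P_trans: "P u w" if uv: "P u v" and vw: "P v w" for u v w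
    unfolding P_def
  proof
    fix x assume "x \<in> K"
    then obtain s t where s: "x @ subst_word \<kappa> u \<approx> s @ x @ subst_word \<kappa> v"
      and t: "x @ subst_word \<kappa> v \<approx> t @ x @ subst_word \<kappa> w"
      using uv vw unfolding P_def by blast
    from trans[OF s left[OF t]] have "x @ subst_word \<kappa> u \<approx> (s @ t) @ x @ subst_word \<kappa> w" by simp
    then show "\<exists>s. x @ subst_word \<kappa> u \<approx> s @ x @ subst_word \<kappa> w" ..
  qed
  have P_ctx: "P (p @ u @ r) (p @ v @ r)" if uv: "P u v" for p r u v
    unfolding P_def
  proof
    fix x assume "x \<in> K"
    then have "x @ subst_word \<kappa> p \<in> K" using kernel_appendR \<kappa>_set unfolding K_def by blast
    then obtain s where "(x @ subst_word \<kappa> p) @ subst_word \<kappa> u \<approx> s @ (x @ subst_word \<kappa> p) @ subst_word \<kappa> v"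
      using uv unfolding P_def by blast
    from right[OF this, of "subst_word \<kappa> r"]
    show "\<exists>s. x @ subst_word \<kappa> (p @ u @ r) \<approx> s @ x @ subst_word \<kappa> (p @ v @ r)"
      by (intro exI[of _ s]) simp
  qed
  have eqv_P: "P u v" if "u \<approx> v" for u v
    unfolding P_def by (intro ballI exI[of _ "[]"]) (simp add: left subst[OF that \<kappa>])
  have Q: "congruence Q"
  proof (rule congruenceI)
    show "Q u u" for u by (simp add: Q_def eqv_P)
    show "Q v u" if "Q u v" for u v using that by (simp add: Q_def)
    show "Q u w" if "Q u v" "Q v w" for u v w using that P_trans unfolding Q_def by blast
    show "Q (p @ u @ r) (p @ v @ r)" if "Q u v" for u v p r using that P_ctx unfolding Q_def by blast
  qed
  have eqv_Q: "Q u v" if "u \<approx> v" for u v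
    using eqv_P[OF that] eqv_P[OF sym[OF that]] by (simp add: Q_def)

  define A where "A = {w. set w \<subseteq> \<Sigma> \<and> length w \<le> 5} - {[]}"
  have A: "finite A" "[] \<notin> A"
    using finite_lists_length_le[of \<Sigma> 5] by (auto simp: A_def \<Sigma>_def)
  have drop_letter: "Q (c # w) w" if "set (c # w) \<subseteq> \<Sigma>" "length w \<ge> 5" for c w
  proof -
    have "\<not> distinct w"
    proof
      assume "distinct w"
      then have "length w = card (set w)" by (simp add: distinct_card)
      also have "\<dots> \<le> card \<Sigma>" using that(1) by (intro card_mono) (auto simp: \<Sigma>_def)
      finally show False using that(2) by (simp add: \<Sigma>_def)
    qed
    then obtain p d u r where w: "w = p @ [d] @ u @ [d] @ r" using not_distinct_decomp by blast
    have *: "\<exists>s. (x @ p') @ [d] @ u @ [d] @ r \<approx> s @ (x @ p'') @ [d] @ u @ [d] @ r"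
      if x: "x \<in> K" and p: "set p' \<subseteq> \<Sigma>" "set p'' \<subseteq> \<Sigma>" for x p' p''
    proof -
      have "x @ p' \<in> K" "x @ p'' \<in> K" using kernel_appendR x p unfolding K_def by blast+
      moreover have "set ([d] @ u @ [d]) \<subseteq> \<Sigma>" using \<open>set (c # w) \<subseteq> \<Sigma>\<close> by (auto simp: w)
      ultimately obtain s where "(x @ p') @ [d] @ u @ [d] \<approx> s @ (x @ p'') @ [d] @ u @ [d]"
        using return_word_constant unfolding K_def by blast
      from right[OF this, of r] show ?thesis by (intro exI[of _ s]) simp
    qed
    have "set p \<subseteq> \<Sigma>" "set (c # p) \<subseteq> \<Sigma>" using that(1) by (auto simp: w)
    then have "\<exists>s. x @ (c # w) \<approx> s @ x @ w" "\<exists>s. x @ w \<approx> s @ x @ (c # w)" if "x \<in> K" for x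
      using *[OF that, of "c # p" p] *[OF that, of p "c # p"] by (simp_all add: w)
    moreover have "subst_word \<kappa> (c # w) = c # w" "subst_word \<kappa> w = w"
      using that(1) by (auto intro!: \<kappa>_id simp del: subst_word_simps)
    ultimately show ?thesis unfolding Q_def P_def by simp
  qed
  have short: "\<exists>v\<in>A. Q w v" if "set w \<subseteq> \<Sigma>" "w \<noteq> []" for w
    using that
  proof (induction w)
    case (Cons c w)
    show ?case
    proof (cases "w = []")
      case True
      then show ?thesis using Cons eqv_Q by (auto simp: A_def intro!: bexI[of _ "[c]"])
    next
      case False
      with Cons obtain v where v: "v \<in> A" "Q w v" by auto
      have cv: "Q (c # w) (c # v)" using P_ctx[of _ _ "[c]" "[]"] v(2) by (simp add: Q_def)
      show ?thesis
      proof (cases "length v \<le> 4")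
        case True
        then show ?thesis using v(1) Cons.prems(1) cv by (auto simp: A_def intro!: bexI[of _ "c # v"])
      next
        case False
        then have "Q (c # v) v" using v(1) Cons.prems(1) by (intro drop_letter) (auto simp: A_def)
        then have "Q (c # w) v" using cv P_trans unfolding Q_def by blast
        then show ?thesis using v(1) by blast
      qed
    qed
  qed simp
  have cl: "\<exists>c\<in>A. Q (u @ v) c" if "u \<in> A" "v \<in> A" for u v
    using that by (intro short) (auto simp: A_def)
  have "[0] \<in> A" "[1] \<in> A" "[2] \<in> A" "[3] \<in> A" by (auto simp: A_def \<Sigma>_def)
  from finite_test[OF Q eqv_Q A cl this]
  have "P (q \<up> n @ a) (a @ q \<up> n)" by (simp add: q_def a_def Q_def)
  moreover have sets: "set q \<subseteq> \<Sigma>" "set a \<subseteq> \<Sigma>" by (auto simp: q_def a_def \<Sigma>_def)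
  then have "set (q \<up> n @ a) \<subseteq> \<Sigma>" "set (a @ q \<up> n) \<subseteq> \<Sigma>"
    using set_word_power[of q n] by auto
  ultimately have cl2: "\<forall>w\<in>K. \<exists>s. w @ q \<up> n @ a \<approx> s @ w @ a @ q \<up> n"
    unfolding P_def using \<kappa>_id by metis
  have "q \<up> n @ a \<in> K"
  proof -
    have "q @ a \<in> K"
      using xhzxyz_in_kernel[OF H, of "[0]" "[3]" "[2]" "[1]"]
      by (simp add: q_def a_def K_def \<Sigma>_def insert_commute)
    moreover obtain m where m: "n = Suc m" using pos by (cases n) auto
    moreover have "set (q \<up> m) \<subseteq> \<Sigma>" using sets(1) set_word_power[of q m] by blast
    ultimately have "q \<up> m @ q @ a \<in> K" using kernel_appendL unfolding K_def by blast
    then show ?thesis by (simp add: m word_power_Suc_right)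
  qed
  moreover from this obtain s where s: "(q \<up> n @ a) @ q \<up> n @ a \<approx> s @ (q \<up> n @ a) @ a @ q \<up> n"
    using cl2 by blast
  moreover obtain r where r: "q \<up> n @ a \<approx> r @ (q \<up> n @ a) @ (q \<up> n @ a)"
    using kernel_left_factor[OF \<open>q \<up> n @ a \<in> K\<close>[unfolded K_def] \<open>set (q \<up> n @ a) \<subseteq> \<Sigma>\<close>] by blast
  ultimately have "q \<up> n @ a \<approx> (r @ s @ q \<up> n @ a) @ a @ q \<up> n"
    using trans[OF r left[OF s]] by simp
  then obtain t where t: "q \<up> n @ a \<approx> t @ a @ q \<up> n" ..
  have 1: "q \<up> n @ a \<approx> idem q @ a"
    using power_n_absorb_left[of "[0]" "[3]" "[2]" "[1]"] by (simp add: q_def a_def)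
  have 2: "a @ q \<up> n \<approx> a @ idem q"
    using power_n_absorb_right[of "[2]" "[0]" "[3]" "[1]"] by (simp add: q_def a_def)
  from trans[OF sym[OF 1] trans[OF t left[OF 2]]] have 3: "idem q @ a \<approx> t @ a @ idem q" .
  note 3
  also have "t @ a @ idem q \<approx> t @ a @ idem q @ idem q" by (intro left sym[OF idem_idem])
  also have "\<dots> = (t @ a @ idem q) @ idem q" by simp
  also have "\<dots> \<approx> (idem q @ a) @ idem q" by (rule right[OF sym[OF 3]])
  finally show ?thesis by (simp add: q_def a_def)
qed

lemma idem_xhz_absorb:
  assumes "x \<noteq> []" "h \<noteq> []" "z \<noteq> []" "y \<noteq> []"
  shows "idem (x @ h @ z) @ x @ y @ z \<approx> idem (x @ h @ z) @ (x @ y @ z) @ idem (x @ h @ z)"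
proof -
  have "idem [0, 3, 2] @ [0, 1, 2] \<approx> idem [0, 3, 2] @ [0, 1, 2] @ idem [0, 3, 2]"
    using absorb_if_alternating_invariant absorb_if_not_alternating_invariant by blast
  from subst[OF this, of "\<lambda>i. if i = 0 then x else if i = 3 then h else if i = 2 then z else y"]
  show ?thesis using assms by simp
qed

end

section \<open>Duality\<close>

lemma rev_subst_word: "rev (subst_word \<phi> w) = subst_word (rev \<circ> \<phi>) (rev w)"
  by (induction w) simp_all

context finitely_tested
begin

text \<open>The reversed identities are the original ones up to exchanging \<open>x\<close> and \<open>z\<close>.\<close>

lemma dual: "finitely_tested n (\<lambda>u v. rev u \<approx> rev v)"
proof
  show "n \<ge> 1" by (rule pos)
  show "congruence (\<lambda>u v. rev u \<approx> rev v)"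
    by (rule congruenceI) (simp_all, erule sym, erule (1) trans, erule ctx[of _ _ "rev _" "rev _", simplified])
  show "rev (subst_word \<phi> u) \<approx> rev (subst_word \<phi> v)"
    if "rev u \<approx> rev v" "\<And>i. \<phi> i \<noteq> []" for u v \<phi>
    unfolding rev_subst_word using that by (intro subst) simp_all
  show "u = [] \<longleftrightarrow> v = []" if "rev u \<approx> rev v" for u v
    using eq_Nil[OF that] by simp
next
  fix Q A x y z h
  assume Q: "congruence Q" and eqv_Q: "\<And>u v. rev u \<approx> rev v \<Longrightarrow> Q u v"
    and A: "finite A" "[] \<notin> A" and cl: "\<And>a b. a \<in> A \<Longrightarrow> b \<in> A \<Longrightarrow> \<exists>c\<in>A. Q (a @ b) c"
    and xyzh: "x \<in> A" "y \<in> A" "z \<in> A" "h \<in> A"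
  define Q' where "Q' u v = Q (rev u) (rev v)" for u v
  have Q_sym: "Q v u" if "Q u v" for u v
    using Q that by (simp add: congruence_def equivp_symp)
  have Q': "congruence Q'"
    using Q unfolding Q'_def congruence_def equivp_def by simp metis
  have eqv_Q': "Q' u v" if "u \<approx> v" for u v
    unfolding Q'_def using that by (intro eqv_Q) simp
  have A': "finite (rev ` A)" "[] \<notin> rev ` A" using A by auto
  have cl': "\<exists>c\<in>rev ` A. Q' (a @ b) c" if "a \<in> rev ` A" "b \<in> rev ` A" for a b
    using that cl unfolding Q'_def by fastforce
  have mem: "rev x \<in> rev ` A" "rev y \<in> rev ` A" "rev z \<in> rev ` A" "rev h \<in> rev ` A"
    using xyzh by simp_all
  have test: "Q' (a \<up> 2) (a \<up> (n + 2)) \<and> Q' (a @ b @ a) ((a @ b) \<up> (n + 1) @ a) \<and>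
      Q' ((a @ d @ c) \<up> n @ a @ b @ c) ((a @ b @ c) @ (a @ d @ c) \<up> n)"
    if "a \<in> rev ` A" "b \<in> rev ` A" "c \<in> rev ` A" "d \<in> rev ` A" for a b c d
    by (rule finite_test[OF Q' _ A' _ that]) (erule eqv_Q', erule (1) cl')
  have "Q (x \<up> 2) (x \<up> (n + 2)) \<and> Q (x @ y @ x) (x @ (y @ x) \<up> (n + 1))"
    using test[OF mem] by (simp add: Q'_def rev_word_power)
  moreover have "Q ((x @ y @ z) @ (x @ h @ z) \<up> n) ((x @ h @ z) \<up> n @ x @ y @ z)"
    using test[OF mem(3,2,1,4)] by (simp add: Q'_def rev_word_power)
  ultimately show "Q (x \<up> 2) (x \<up> (n + 2)) \<and> Q (x @ y @ x) ((x @ y) \<up> (n + 1) @ x) \<and>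
      Q ((x @ h @ z) \<up> n @ x @ y @ z) ((x @ y @ z) @ (x @ h @ z) \<up> n)"
    using Q_sym word_power_slide[of x y "n + 1"] by simp
qed

lemma xhz_law:
  assumes ne: "x \<noteq> []" "h \<noteq> []" "z \<noteq> []" "y \<noteq> []"
  shows "(x @ h @ z) \<up> n @ x @ y @ z \<approx> (x @ y @ z) @ (x @ h @ z) \<up> n"
proof -
  let ?e = "idem (x @ h @ z)"
  interpret rev: finitely_tested n "\<lambda>u v. rev u \<approx> rev v" by (rule dual)
  have "(x @ y @ z) @ ?e \<approx> ?e @ (x @ y @ z) @ ?e"
    using rev.idem_xhz_absorb[of "rev z" "rev h" "rev x" "rev y"] ne by (simp add: rev_word_power)
  note right_absorb = sym[OF this]
  have "(x @ h @ z) \<up> n @ x @ y @ z \<approx> ?e @ x @ y @ z"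
    using ne by (intro power_n_absorb_left) simp_all
  also have "\<dots> \<approx> ?e @ (x @ y @ z) @ ?e" by (rule idem_xhz_absorb[OF ne])
  also note right_absorb
  also have "(x @ y @ z) @ ?e \<approx> (x @ y @ z) @ (x @ h @ z) \<up> n"
    using ne by (intro sym[OF power_n_absorb_right]) simp_all
  finally show ?thesis .
qed

lemma xyzh_identities_hold:
  assumes "(u, v) \<in> xyzh_identities n"
  shows "u \<approx> v"
  using assms power_law[of "[0]"] xyx_law[of "[0]" "[1]"] xhz_law[of "[0]" "[3]" "[2]" "[1]"]
  by (auto simp: xyzh_identities_def)

end

section \<open>Equational consequences\<close>

text \<open>Equational logic over words: derivability does not refer to the type of the carrier, which is why results for
  finite semigroups of natural numbers transfer to semigroups on an arbitrary type.\<close>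

inductive consequence :: "(word \<times> word) set \<Rightarrow> word \<Rightarrow> word \<Rightarrow> bool" for E where
  axiom: "(u, v) \<in> E \<Longrightarrow> (\<And>i. \<phi> i \<noteq> [])
    \<Longrightarrow> consequence E (p @ subst_word \<phi> u @ q) (p @ subst_word \<phi> v @ q)"
| refl: "consequence E u u"
| sym: "consequence E u v \<Longrightarrow> consequence E v u"
| trans: "consequence E u v \<Longrightarrow> consequence E v w \<Longrightarrow> consequence E u w"

lemma subst_word_eq_Nil: "(\<And>i. \<phi> i \<noteq> []) \<Longrightarrow> subst_word \<phi> w = [] \<longleftrightarrow> w = []"
  by (cases w) simp_all

lemma consequence_Nil:
  assumes "consequence E u v" "E \<subseteq> identities"
  shows "u = [] \<longleftrightarrow> v = []"
  using assms
  by induction (auto simp: identities_def subst_word_eq_Nil)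

lemma congruence_consequence: "congruence (consequence E)"
proof (rule congruenceI)
  show "consequence E (p @ u @ q) (p @ v @ q)" if "consequence E u v" for u v p q
    using that
  proof induction
    case (axiom u v \<phi> r s)
    then show ?case using consequence.axiom[of u v E \<phi> "p @ r" "s @ q"] by simp
  qed (blast intro: consequence.refl consequence.sym consequence.trans)+
qed (blast intro: consequence.refl consequence.sym consequence.trans)+

lemma consequence_subst:
  assumes "consequence E u v" "\<And>i. \<psi> i \<noteq> []"
  shows "consequence E (subst_word \<psi> u) (subst_word \<psi> v)"
  using assms(1)
proof induction
  case (axiom u v \<phi> p q)
  have "(subst_word \<psi> \<circ> \<phi>) i \<noteq> []" for i
    using axiom(2)[of i] assms(2) by (simp add: subst_word_eq_Nil)
  with consequence.axiom[OF axiom(1), of "subst_word \<psi> \<circ> \<phi>" "subst_word \<psi> p" "subst_word \<psi> q"]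
  show ?case by (simp add: subst_word_comp)
qed (blast intro: consequence.refl consequence.sym consequence.trans)+

lemma word_value_Cons: "w \<noteq> [] \<Longrightarrow> word_value f s (i # w) = f (s i) (word_value f s w)"
  by (cases w) simp_all

lemma word_value_in:
  assumes "semigroup_on S f" "\<And>i. s i \<in> S" "w \<noteq> []"
  shows "word_value f s w \<in> S"
  using assms(3)
proof (induction w rule: induct_list012)
  case (3 a b w)
  then have "word_value f s (b # w) \<in> S" by blast
  then show ?case using assms(1,2) by (simp add: semigroup_on_def)
qed (simp_all add: assms)

lemma word_value_append:
  assumes S: "semigroup_on S f" "\<And>i. s i \<in> S" and "u \<noteq> []" "v \<noteq> []"
  shows "word_value f s (u @ v) = f (word_value f s u) (word_value f s v)"
  using assms(3)
proof (induction u)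
  case (Cons a u)
  show ?case
  proof (cases "u = []")
    case False
    then show ?thesis
      using Cons assms(4) S word_value_in[OF S]
      by (simp add: word_value_Cons semigroup_on_def)
  qed (simp add: word_value_Cons assms(4))
qed simp

lemma word_value_subst_word:
  assumes S: "semigroup_on S f" "\<And>i. s i \<in> S" and "\<And>i. \<phi> i \<noteq> []" "w \<noteq> []"
  shows "word_value f s (subst_word \<phi> w) = word_value f (\<lambda>i. word_value f s (\<phi> i)) w"
  using assms(4)
proof (induction w)
  case (Cons a w)
  then show ?case
    using word_value_append[OF S, of "\<phi> a" "subst_word \<phi> w"] assms(3)
    by (cases "w = []") (simp_all add: word_value_Cons subst_word_eq_Nil)
qed simp

lemma word_value_context:
  assumes S: "semigroup_on S f" "\<And>i. s i \<in> S" and "u \<noteq> []" "v \<noteq> []"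
    and uv: "word_value f s u = word_value f s v"
  shows "word_value f s (p @ u @ q) = word_value f s (p @ v @ q)"
proof -
  have "word_value f s (u @ q) = word_value f s (v @ q)"
    using assms(3,4) uv word_value_append[OF S] by (cases "q = []") simp_all
  then show ?thesis
    using assms(3,4) word_value_append[OF S] by (cases "p = []") simp_all
qed

lemma consequence_sound:
  assumes "consequence E u v" "u \<noteq> []" "E \<subseteq> identities" "(S, f) \<in> variety E"
  shows "satisfies S f (u, v)"
proof -
  have S: "semigroup_on S f" using assms(4) by (simp add: variety_def)
  have "word_value f s u = word_value f s v" if s: "\<And>i. s i \<in> S" for s
    using assms(1,2)
  proof induction
    case (axiom u v \<phi> p q)
    then have ne: "u \<noteq> []" "v \<noteq> []" using assms(3) by (auto simp: identities_def)
    have "satisfies S f (u, v)" using assms(4) axiom(1) by (auto simp: variety_def)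
    then have "word_value f (\<lambda>i. word_value f s (\<phi> i)) u = word_value f (\<lambda>i. word_value f s (\<phi> i)) v"
      using word_value_in[OF S s axiom(2)] by (simp add: satisfies_def)
    then show ?case
      using ne axiom(2)
      by (intro word_value_context[OF S s]) (simp_all add: subst_word_eq_Nil word_value_subst_word[OF S s])
  next
    case (sym u v)
    then show ?case using consequence_Nil[OF sym(1) assms(3)] by simp
  next
    case (trans u v w)
    then show ?case using consequence_Nil[OF trans(1) assms(3)] by simp
  qed simp
  then show ?thesis by (simp add: satisfies_def)
qed

lemma xyzh_identities_nonempty: "xyzh_identities n \<subseteq> identities"
  by (simp add: xyzh_identities_def identities_def)

text \<open>The classes of the words in \<open>A\<close> form a finite semigroup: it belongs to the variety because \<open>Q\<close>
  contains all substitution instances of \<open>E\<close>.  It therefore satisfies the three identities.\<close>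

lemma consequence_finitely_tested:
  fixes n :: nat
  assumes n: "n \<ge> 1" and E: "E \<subseteq> identities"
    and fin: "\<forall>(S :: nat set, f) \<in> variety E. finite S \<longrightarrow> (\<forall>e \<in> xyzh_identities n. satisfies S f e)"
  shows "finitely_tested n (consequence E)"
proof
  show "n \<ge> 1" by (rule n)
  show "congruence (consequence E)" by (rule congruence_consequence)
  show "consequence E (subst_word \<phi> u) (subst_word \<phi> v)"
    if "consequence E u v" "\<And>i. \<phi> i \<noteq> []" for u v \<phi>
    using that by (rule consequence_subst)
  show "u = [] \<longleftrightarrow> v = []" if "consequence E u v" for u v
    using that E by (rule consequence_Nil)
next
  fix Q A x y z h
  assume Q: "congruence Q" and eqv_Q: "\<And>u v. consequence E u v \<Longrightarrow> Q u v"
    and A: "finite A" "[] \<notin> A" and cl: "\<And>a b. a \<in> A \<Longrightarrow> b \<in> A \<Longrightarrow> \<exists>c\<in>A. Q (a @ b) c"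
    and xyzh: "x \<in> A" "y \<in> A" "z \<in> A" "h \<in> A"
  define cls where "cls a = {v. Q a v}" for a
  define mult where "mult X Y = {v. \<exists>a\<in>X. \<exists>b\<in>Y. Q (a @ b) v}" for X Y
  have equiv: "equivp Q" using Q by (simp add: congruence_def)
  have cls_eq: "cls a = cls b \<longleftrightarrow> Q a b" for a b
    using equiv unfolding cls_def equivp_def by auto
  have mult: "mult (cls a) (cls b) = cls (a @ b)" for a b
  proof
    show "mult (cls a) (cls b) \<subseteq> cls (a @ b)"
      unfolding mult_def cls_def using congruence_append[OF Q] equivp_transp[OF equiv] by blast
    show "cls (a @ b) \<subseteq> mult (cls a) (cls b)"
      unfolding mult_def cls_def using equivp_reflp[OF equiv] by blast
  qed
  define C where "C = cls ` A"
  have mult_C: "mult X Y \<in> C" if XY: "X \<in> C" "Y \<in> C" for X Y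
  proof -
    obtain a b where ab: "X = cls a" "Y = cls b" "a \<in> A" "b \<in> A" using XY by (auto simp: C_def)
    obtain c where "c \<in> A" "Q (a @ b) c" using cl[OF ab(3,4)] by blast
    then have "mult X Y = cls c" by (simp add: ab mult cls_eq)
    then show ?thesis using \<open>c \<in> A\<close> by (simp add: C_def)
  qed
  have C: "semigroup_on C mult"
    using xyzh(1) mult_C by (auto simp: semigroup_on_def C_def mult)
  have val: "word_value mult (\<lambda>i. cls (\<phi> i)) w = cls (subst_word \<phi> w)" if "w \<noteq> []" for \<phi> w
    using that by (induction w rule: induct_list012) (simp_all add: mult)
  have sat_iff: "satisfies C mult e \<longleftrightarrow>
      (\<forall>\<phi>. (\<forall>i. \<phi> i \<in> A) \<longrightarrow> Q (subst_word \<phi> (fst e)) (subst_word \<phi> (snd e)))"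
    if e: "e \<in> identities" for e
  proof -
    have ne: "fst e \<noteq> []" "snd e \<noteq> []" using e by (auto simp: identities_def)
    have val_eq: "word_value mult (\<lambda>i. cls (\<phi> i)) (fst e) = word_value mult (\<lambda>i. cls (\<phi> i)) (snd e)
        \<longleftrightarrow> Q (subst_word \<phi> (fst e)) (subst_word \<phi> (snd e))" for \<phi>
      by (simp only: val[OF ne(1)] val[OF ne(2)] cls_eq)
    show ?thesis
    proof
      assume L: "satisfies C mult e"
      show "\<forall>\<phi>. (\<forall>i. \<phi> i \<in> A) \<longrightarrow> Q (subst_word \<phi> (fst e)) (subst_word \<phi> (snd e))"
        unfolding val_eq[symmetric] using L unfolding satisfies_def C_def by simp
    next
      assume R: "\<forall>\<phi>. (\<forall>i. \<phi> i \<in> A) \<longrightarrow> Q (subst_word \<phi> (fst e)) (subst_word \<phi> (snd e))"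
      show "satisfies C mult e"
        unfolding satisfies_def
      proof (intro allI impI)
        fix s :: "nat \<Rightarrow> word set" assume "\<forall>i. s i \<in> C"
        then have "\<forall>i. \<exists>a. a \<in> A \<and> s i = cls a" by (auto simp: C_def)
        from choice[OF this] obtain \<phi> where \<phi>: "\<forall>i. \<phi> i \<in> A" "s = (\<lambda>i. cls (\<phi> i))"
          by blast
        show "word_value mult s (fst e) = word_value mult s (snd e)"
          unfolding \<phi>(2) val_eq using R \<phi>(1) by blast
      qed
    qed
  qed
  have "satisfies C mult e" if "e \<in> E" for e
  proof -
    obtain u v where e: "e = (u, v)" by (cases e)
    have "Q (subst_word \<phi> u) (subst_word \<phi> v)" if \<phi>: "\<forall>i. \<phi> i \<in> A" for \<phi>
    proof -
      have "\<phi> i \<noteq> []" for i using \<phi> A(2) by metis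
      with \<open>e \<in> E\<close> have "consequence E ([] @ subst_word \<phi> u @ []) ([] @ subst_word \<phi> v @ [])"
        unfolding e by (intro consequence.axiom)
      then show ?thesis by (intro eqv_Q) simp
    qed
    then show ?thesis using sat_iff[of e] \<open>e \<in> E\<close> E by (auto simp: e)
  qed
  then have "(C, mult) \<in> variety E" using C by (auto simp: variety_def)
  moreover have "finite C" using A(1) by (simp add: C_def)
  moreover have id: "e \<in> identities" if "e \<in> xyzh_identities n" for e
    using that xyzh_identities_nonempty by blast
  ultimately have "satisfies C mult e" if "e \<in> xyzh_identities n" for e
    using finite_members_nat[OF E id[OF that]] fin that by fast
  then have test: "Q (subst_word \<phi> (fst e)) (subst_word \<phi> (snd e))"
    if "e \<in> xyzh_identities n" "\<forall>i. \<phi> i \<in> A" for e \<phi>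
    using sat_iff[OF id[OF that(1)]] that by blast
  define \<phi> where "\<phi> i = (if i = 0 then x else if i = 1 then y else if i = 2 then z else h)" for i :: nat
  have "\<forall>i. \<phi> i \<in> A" using xyzh by (simp add: \<phi>_def)
  then have "\<forall>e\<in>xyzh_identities n. Q (subst_word \<phi> (fst e)) (subst_word \<phi> (snd e))"
    by (intro ballI test)
  then show "Q (x \<up> 2) (x \<up> (n + 2)) \<and> Q (x @ y @ x) ((x @ y) \<up> (n + 1) @ x) \<and>
      Q ((x @ h @ z) \<up> n @ x @ y @ z) ((x @ y @ z) @ (x @ h @ z) \<up> n)"
    unfolding xyzh_identities_def Let_def by (simp add: \<phi>_def)
qed

theorem corollary2:
  fixes n :: nat and E :: "(word \<times> word) set"
  assumes "n \<ge> 1" and "E \<subseteq> identities"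
    and "\<forall>(S :: nat set, f) \<in> variety E. finite S \<longrightarrow>
           (\<forall>e \<in> xyzh_identities n. satisfies S f e)"
  shows "\<forall>(S :: 'a set, f) \<in> variety E.
           (\<forall>e \<in> xyzh_identities n. satisfies S f e)"
proof -
  interpret finitely_tested n "consequence E"
    using assms by (rule consequence_finitely_tested)
  have "satisfies S f (u, v)" if "(S, f) \<in> variety E" "(u, v) \<in> xyzh_identities n"
    for S :: "'a set" and f u v
  proof (rule consequence_sound)
    show "consequence E u v" by (rule xyzh_identities_hold[OF that(2)])
    show "u \<noteq> []" using that(2) xyzh_identities_nonempty by (auto simp: identities_def)
  qed (use assms(2) that(1) in auto)
  then show ?thesis by auto
qed

end
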